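(* Let $\Gamma$ be a group and $\mathbb{G}=[\partial:G_1\to G_0]$ a $\Gamma$-crossed-module with a $\Gamma$-equivariant braiding. When the braiding on $\mathbb{G}$ is symmetric (i.e. $\{g,h\}\{h,g\}=1$ for all $g,h\in G_0$), the group structure on $H^1(\Gamma,\mathbb{G})$ (induced by the product on $Z^1(\Gamma,\mathbb{G})$) is abelian.
   Context: A crossed-module $\mathbb{G}=[\partial:G_1\to G_0]$ is a group homomorphism with a right action of $G_0$ on $G_1$ by automorphisms such that $\partial(\alpha^g)=g^{-1}\partial(\alpha)g$ and $\alpha^{\partial\beta}=\beta^{-1}\alpha\beta$. A $\Gamma$-crossed-module is one with left actions of $\Gamma$ on $G_0,G_1$ by automorphisms, with $\partial$ $\Gamma$-equivariant and ${}^{\sigma}(\alpha^g)=({}^{\sigma}\alpha)^{({}^{\sigma}g)}$. A braiding is a map $\{,\}:G_0\times G_0\to G_1$ with $\partial\{g,h\}=g^{-1}h^{-1}gh$; $\{\partial\alpha,g\}=\alpha^{-1}\alpha^g$; $\{g,\partial\alpha\}=(\alpha^{-1})^g\alpha$; $\{g,hk\}=\{g,k\}\{g,h\}^k$; $\{gh,k\}=\{g,k\}^h\{h,k\}$. It is $\Gamma$-equivariant if $\{{}^{\sigma}g,{}^{\sigma}h\}={}^{\sigma}\{g,h\}$. Pointed maps preserve identity elements. $Z^1(\Gamma,\mathbb{G})$ is the set of pairs $(p,\varepsilon)$ of pointed maps $p:\Gamma\to G_0$, $\varepsilon:\Gamma\times\Gamma\to G_1$ with $p(\sigma\tau)\,\partial\varepsilon(\sigma,\tau)=p(\sigma)\,{}^{\sigma}p(\tau)$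 and $\varepsilon(\sigma,\tau\upsilon)\,{}^{\sigma}\varepsilon(\tau,\upsilon)=\varepsilon(\sigma\tau,\upsilon)\,\varepsilon(\sigma,\tau)^{{}^{\sigma\tau}p(\upsilon)}$. Two cocycles $(p_1,\varepsilon_1),(p_2,\varepsilon_2)$ are isomorphic if there are $g\in G_0$ and a pointed map $\theta:\Gamma\to G_1$ with $p_2(\sigma)=g^{-1}p_1(\sigma)\,{}^{\sigma}g\,\partial\theta(\sigma)^{-1}$ and $\varepsilon_2(\sigma,\tau)=\theta(\sigma\tau)\,\varepsilon_1(\sigma,\tau)^{{}^{\sigma\tau}g}\,{}^{\sigma}\theta(\tau)^{-1}\,(\theta(\sigma)^{-1})^{{}^{\sigma}p_2(\tau)}$ for all $\sigma,\tau$. $H^1(\Gamma,\mathbb{G})$ is the set of isomorphism classes. Using the braiding, $Z^1(\Gamma,\mathbb{G})$ is a group under $(p_1,\varepsilon_1)(p_2,\varepsilon_2)=(p,\varepsilon)$, with $p(\sigma)=p_1(\sigma)p_2(\sigma)$ and $\varepsilon(\sigma,\tau)=\varepsilon_1(\sigma,\tau)^{p_2(\sigma\tau)}\,\varepsilon_2(\sigma,\tau)\,\{p_2(\sigma),{}^{\sigma}p_1(\tau)\}^{{}^{\sigma}p_2(\tau)}$, and this product descends to a group structure on $H^1(\Gamma,\mathbb{G})$. *)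

theory Defs
  imports "HOL-Algebra.Group"
begin

text \<open>
  Invertibility of each \<open>act \<sigma>\<close> follows from the last two axioms, so \<open>act\<close> is an action
  by automorphisms; likewise for the right action below.
\<close>

locale left_aut_action =
  \<Gamma>: group \<Gamma> + A: group A
  for \<Gamma> :: "('c, 'm) monoid_scheme" and A :: "('a, 'n) monoid_scheme" +
  fixes act :: "'c \<Rightarrow> 'a \<Rightarrow> 'a"
  assumes act_hom: "\<sigma> \<in> carrier \<Gamma> \<Longrightarrow> act \<sigma> \<in> hom A A"
    and act_one: "a \<in> carrier A \<Longrightarrow> act \<one>\<^bsub>\<Gamma>\<^esub> a = a"
    and act_mult: "\<lbrakk>\<sigma> \<in> carrier \<Gamma>; \<tau> \<in> carrier \<Gamma>; a \<in> carrier A\<rbrakk>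
      \<Longrightarrow> act (\<sigma> \<otimes>\<^bsub>\<Gamma>\<^esub> \<tau>) a = act \<sigma> (act \<tau> a)"

locale right_aut_action =
  G: group G + A: group A
  for G :: "('a, 'm) monoid_scheme" and A :: "('b, 'n) monoid_scheme" +
  fixes ract :: "'b \<Rightarrow> 'a \<Rightarrow> 'b"
  assumes ract_hom: "g \<in> carrier G \<Longrightarrow> (\<lambda>\<alpha>. ract \<alpha> g) \<in> hom A A"
    and ract_one: "\<alpha> \<in> carrier A \<Longrightarrow> ract \<alpha> \<one>\<^bsub>G\<^esub> = \<alpha>"
    and ract_mult: "\<lbrakk>g \<in> carrier G; h \<in> carrier G; \<alpha> \<in> carrier A\<rbrakk>
      \<Longrightarrow> ract \<alpha> (g \<otimes>\<^bsub>G\<^esub> h) = ract (ract \<alpha> g) h"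

locale crossed_module =
  bd: group_hom G1 G0 bd + ract: right_aut_action G0 G1 ract
  for G1 :: "('b, 'n) monoid_scheme" and G0 :: "('a, 'm) monoid_scheme"
    and bd :: "'b \<Rightarrow> 'a" and ract :: "'b \<Rightarrow> 'a \<Rightarrow> 'b" (infixl "\<triangleleft>" 75) +
  assumes bd_ract: "\<lbrakk>\<alpha> \<in> carrier G1; g \<in> carrier G0\<rbrakk>
      \<Longrightarrow> bd (\<alpha> \<triangleleft> g) = inv\<^bsub>G0\<^esub> g \<otimes>\<^bsub>G0\<^esub> bd \<alpha> \<otimes>\<^bsub>G0\<^esub> g"
    and ract_bd: "\<lbrakk>\<alpha> \<in> carrier G1; \<beta> \<in> carrier G1\<rbrakk>
      \<Longrightarrow> \<alpha> \<triangleleft> bd \<beta> = inv\<^bsub>G1\<^esub> \<beta> \<otimes>\<^bsub>G1\<^esub> \<alpha> \<otimes>\<^bsub>G1\<^esub> \<beta>"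

locale equivariant_crossed_module =
  crossed_module G1 G0 bd ract +
  act0: left_aut_action \<Gamma> G0 act0 + act1: left_aut_action \<Gamma> G1 act1
  for \<Gamma> :: "('c, 'k) monoid_scheme"
    and G1 :: "('b, 'n) monoid_scheme" and G0 :: "('a, 'm) monoid_scheme"
    and bd :: "'b \<Rightarrow> 'a" and ract :: "'b \<Rightarrow> 'a \<Rightarrow> 'b" (infixl "\<triangleleft>" 75)
    and act0 :: "'c \<Rightarrow> 'a \<Rightarrow> 'a" and act1 :: "'c \<Rightarrow> 'b \<Rightarrow> 'b" +
  assumes bd_act: "\<lbrakk>\<sigma> \<in> carrier \<Gamma>; \<alpha> \<in> carrier G1\<rbrakk> \<Longrightarrow> bd (act1 \<sigma> \<alpha>) = act0 \<sigma> (bd \<alpha>)"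
    and act_ract: "\<lbrakk>\<sigma> \<in> carrier \<Gamma>; \<alpha> \<in> carrier G1; g \<in> carrier G0\<rbrakk>
      \<Longrightarrow> act1 \<sigma> (\<alpha> \<triangleleft> g) = act1 \<sigma> \<alpha> \<triangleleft> act0 \<sigma> g"
begin

text \<open>
  Maps out of \<open>\<Gamma>\<close> and \<open>\<Gamma> \<times> \<Gamma>\<close> are taken extensional (\<open>undefined\<close> off the carrier), so that
  equality of cocycles is equality as maps on the carriers.
\<close>

definition Z1 :: "(('c \<Rightarrow> 'a) \<times> ('c \<times> 'c \<Rightarrow> 'b)) set" where
  "Z1 = {(p, \<epsilon>).
     p \<in> carrier \<Gamma> \<rightarrow>\<^sub>E carrier G0 \<and> p \<one>\<^bsub>\<Gamma>\<^esub> = \<one>\<^bsub>G0\<^esub> \<and>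
     \<epsilon> \<in> carrier \<Gamma> \<times> carrier \<Gamma> \<rightarrow>\<^sub>E carrier G1 \<and> \<epsilon> (\<one>\<^bsub>\<Gamma>\<^esub>, \<one>\<^bsub>\<Gamma>\<^esub>) = \<one>\<^bsub>G1\<^esub> \<and>
     (\<forall>\<sigma>\<in>carrier \<Gamma>. \<forall>\<tau>\<in>carrier \<Gamma>.
        p (\<sigma> \<otimes>\<^bsub>\<Gamma>\<^esub> \<tau>) \<otimes>\<^bsub>G0\<^esub> bd (\<epsilon> (\<sigma>, \<tau>)) = p \<sigma> \<otimes>\<^bsub>G0\<^esub> act0 \<sigma> (p \<tau>)) \<and>
     (\<forall>\<sigma>\<in>carrier \<Gamma>. \<forall>\<tau>\<in>carrier \<Gamma>. \<forall>\<upsilon>\<in>carrier \<Gamma>.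
        \<epsilon> (\<sigma>, \<tau> \<otimes>\<^bsub>\<Gamma>\<^esub> \<upsilon>) \<otimes>\<^bsub>G1\<^esub> act1 \<sigma> (\<epsilon> (\<tau>, \<upsilon>)) =
        \<epsilon> (\<sigma> \<otimes>\<^bsub>\<Gamma>\<^esub> \<tau>, \<upsilon>) \<otimes>\<^bsub>G1\<^esub> (\<epsilon> (\<sigma>, \<tau>) \<triangleleft> act0 (\<sigma> \<otimes>\<^bsub>\<Gamma>\<^esub> \<tau>) (p \<upsilon>)))}"

definition cocycle_iso ::
  "((('c \<Rightarrow> 'a) \<times> ('c \<times> 'c \<Rightarrow> 'b)) \<times> (('c \<Rightarrow> 'a) \<times> ('c \<times> 'c \<Rightarrow> 'b))) set" where
  "cocycle_iso = {((p1, \<epsilon>1), (p2, \<epsilon>2)).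
     (p1, \<epsilon>1) \<in> Z1 \<and> (p2, \<epsilon>2) \<in> Z1 \<and>
     (\<exists>g\<in>carrier G0. \<exists>\<theta>\<in>carrier \<Gamma> \<rightarrow> carrier G1. \<theta> \<one>\<^bsub>\<Gamma>\<^esub> = \<one>\<^bsub>G1\<^esub> \<and>
       (\<forall>\<sigma>\<in>carrier \<Gamma>.
          p2 \<sigma> = inv\<^bsub>G0\<^esub> g \<otimes>\<^bsub>G0\<^esub> p1 \<sigma> \<otimes>\<^bsub>G0\<^esub> act0 \<sigma> g \<otimes>\<^bsub>G0\<^esub> inv\<^bsub>G0\<^esub> bd (\<theta> \<sigma>)) \<and>
       (\<forall>\<sigma>\<in>carrier \<Gamma>. \<forall>\<tau>\<in>carrier \<Gamma>.
          \<epsilon>2 (\<sigma>, \<tau>) =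
          \<theta> (\<sigma> \<otimes>\<^bsub>\<Gamma>\<^esub> \<tau>) \<otimes>\<^bsub>G1\<^esub> (\<epsilon>1 (\<sigma>, \<tau>) \<triangleleft> act0 (\<sigma> \<otimes>\<^bsub>\<Gamma>\<^esub> \<tau>) g)
            \<otimes>\<^bsub>G1\<^esub> inv\<^bsub>G1\<^esub> act1 \<sigma> (\<theta> \<tau>) \<otimes>\<^bsub>G1\<^esub> (inv\<^bsub>G1\<^esub> \<theta> \<sigma> \<triangleleft> act0 \<sigma> (p2 \<tau>))))}"

end

locale braided_equivariant_crossed_module =
  equivariant_crossed_module \<Gamma> G1 G0 bd ract act0 act1
  for \<Gamma> :: "('c, 'k) monoid_scheme"
    and G1 :: "('b, 'n) monoid_scheme" and G0 :: "('a, 'm) monoid_scheme"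
    and bd :: "'b \<Rightarrow> 'a" and ract :: "'b \<Rightarrow> 'a \<Rightarrow> 'b" (infixl "\<triangleleft>" 75)
    and act0 :: "'c \<Rightarrow> 'a \<Rightarrow> 'a" and act1 :: "'c \<Rightarrow> 'b \<Rightarrow> 'b" +
  fixes br :: "'a \<Rightarrow> 'a \<Rightarrow> 'b"
  assumes br_closed: "\<lbrakk>g \<in> carrier G0; h \<in> carrier G0\<rbrakk> \<Longrightarrow> br g h \<in> carrier G1"
    and bd_br: "\<lbrakk>g \<in> carrier G0; h \<in> carrier G0\<rbrakk>
      \<Longrightarrow> bd (br g h) = inv\<^bsub>G0\<^esub> g \<otimes>\<^bsub>G0\<^esub> inv\<^bsub>G0\<^esub> h \<otimes>\<^bsub>G0\<^esub> g \<otimes>\<^bsub>G0\<^esub> h"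
    and br_bd_left: "\<lbrakk>\<alpha> \<in> carrier G1; g \<in> carrier G0\<rbrakk>
      \<Longrightarrow> br (bd \<alpha>) g = inv\<^bsub>G1\<^esub> \<alpha> \<otimes>\<^bsub>G1\<^esub> (\<alpha> \<triangleleft> g)"
    and br_bd_right: "\<lbrakk>\<alpha> \<in> carrier G1; g \<in> carrier G0\<rbrakk>
      \<Longrightarrow> br g (bd \<alpha>) = (inv\<^bsub>G1\<^esub> \<alpha> \<triangleleft> g) \<otimes>\<^bsub>G1\<^esub> \<alpha>"
    and br_mult_right: "\<lbrakk>g \<in> carrier G0; h \<in> carrier G0; k \<in> carrier G0\<rbrakk>
      \<Longrightarrow> br g (h \<otimes>\<^bsub>G0\<^esub> k) = br g k \<otimes>\<^bsub>G1\<^esub> (br g h \<triangleleft> k)"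
    and br_mult_left: "\<lbrakk>g \<in> carrier G0; h \<in> carrier G0; k \<in> carrier G0\<rbrakk>
      \<Longrightarrow> br (g \<otimes>\<^bsub>G0\<^esub> h) k = (br g k \<triangleleft> h) \<otimes>\<^bsub>G1\<^esub> br h k"
    and br_act: "\<lbrakk>\<sigma> \<in> carrier \<Gamma>; g \<in> carrier G0; h \<in> carrier G0\<rbrakk>
      \<Longrightarrow> br (act0 \<sigma> g) (act0 \<sigma> h) = act1 \<sigma> (br g h)"
begin

fun cocycle_mult ::
  "('c \<Rightarrow> 'a) \<times> ('c \<times> 'c \<Rightarrow> 'b) \<Rightarrow> ('c \<Rightarrow> 'a) \<times> ('c \<times> 'c \<Rightarrow> 'b)
    \<Rightarrow> ('c \<Rightarrow> 'a) \<times> ('c \<times> 'c \<Rightarrow> 'b)" where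
  "cocycle_mult (p1, \<epsilon>1) (p2, \<epsilon>2) =
     (\<lambda>\<sigma>\<in>carrier \<Gamma>. p1 \<sigma> \<otimes>\<^bsub>G0\<^esub> p2 \<sigma>,
      \<lambda>(\<sigma>, \<tau>)\<in>carrier \<Gamma> \<times> carrier \<Gamma>.
        (\<epsilon>1 (\<sigma>, \<tau>) \<triangleleft> p2 (\<sigma> \<otimes>\<^bsub>\<Gamma>\<^esub> \<tau>)) \<otimes>\<^bsub>G1\<^esub> \<epsilon>2 (\<sigma>, \<tau>)
          \<otimes>\<^bsub>G1\<^esub> (br (p2 \<sigma>) (act0 \<sigma> (p1 \<tau>)) \<triangleleft> act0 \<sigma> (p2 \<tau>)))"

definition cocycle_one :: "('c \<Rightarrow> 'a) \<times> ('c \<times> 'c \<Rightarrow> 'b)" where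
  "cocycle_one = (\<lambda>\<sigma>\<in>carrier \<Gamma>. \<one>\<^bsub>G0\<^esub>, \<lambda>(\<sigma>, \<tau>)\<in>carrier \<Gamma> \<times> carrier \<Gamma>. \<one>\<^bsub>G1\<^esub>)"

text \<open>
  The product of two classes collects the cocycles isomorphic to a product of representatives.
  It is again a single class precisely when the product of cocycles respects isomorphism.
\<close>

definition H1 :: "(('c \<Rightarrow> 'a) \<times> ('c \<times> 'c \<Rightarrow> 'b)) set monoid" where
  "H1 = \<lparr>carrier = Z1 // cocycle_iso,
         mult = (\<lambda>X Y. \<Union>x\<in>X. \<Union>y\<in>Y. cocycle_iso `` {cocycle_mult x y}),
         one = cocycle_iso `` {cocycle_one}\<rparr>"

end

end

theory Submission
  imports Defs
begin

text \<open>
  A crossed module is a strict monoidal groupoid in disguise: the objects are the elements of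
  \<open>G0\<close>, and \<open>\<alpha> \<in> G1\<close> is a morphism \<open>u \<rightarrow> u \<bullet> bd \<alpha>\<close> for every \<open>u\<close>. Tensoring a morphism with an object
  on its right is the action \<open>\<triangleleft>\<close>, tensoring on its left changes nothing, and composition is the
  product of \<open>G1\<close> in the order of the arrows. In this reading the crossed module law \<open>ract_bd\<close> is
  the interchange law (lemma \<open>slide\<close>), and \<open>br g h\<close> is a natural morphism \<open>h \<bullet> g \<rightarrow> g \<bullet> h\<close> (lemmas
  \<open>br_nat_left\<close> and \<open>br_nat_right\<close>). A cocycle is a \<open>\<Gamma>\<close>-twisted functor with comparison morphisms
  \<open>\<epsilon> (\<sigma>, \<tau>) : p (\<sigma>\<tau>) \<rightarrow> p \<sigma> \<bullet> \<sigma>(p \<tau>)\<close>, and the product of two cocycles is their pointwise tensor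
  product, in which the braiding moves the middle factors past each other.

  If the braiding is symmetric, then \<open>br (p1 \<sigma>) (p2 \<sigma>)\<close> is a natural isomorphism between the two
  products of two cocycles. So the product on cocycles is commutative up to isomorphism. The
  symmetry enters at exactly one point: in the naturality square the letters \<open>b1\<close> and \<open>a2\<close> cross once
  in each order, and these two crossings have to cancel (lemma \<open>mult_commute_identity\<close>).

  That the classes form a group at all also has to be shown, and commutativity shortens this.
  On cocycles the product is strictly associative and unital. It respects isomorphism
  in its left factor by a direct computation (\<open>mult_iso_left_identity\<close>), hence also in its right
  factor by commutativity. For inverses, the cocycle identities of a product are shown to be
  \<^emph>\<open>equivalent\<close> to those of the second factor once the first factor is a cocycle
  (\<open>cocycle_mult_mem_iff\<close>). Hence the second factor can be solved for from the condition that the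
  product be trivial, and it is automatically a cocycle.
\<close>

section \<open>Groups as quotients by a congruence\<close>

text \<open>
  Up to the relation \<open>R\<close> the product is commutative, so a congruence property on one side gives it
  on the other, and a one-sided inverse up to \<open>R\<close> is enough.
\<close>
lemma comm_group_quotient:
  fixes M (structure)
  assumes closed: "\<And>x y. \<lbrakk>x \<in> carrier M; y \<in> carrier M\<rbrakk> \<Longrightarrow> x \<otimes> y \<in> carrier M"
    and one: "\<one> \<in> carrier M"
    and assoc: "\<And>x y z. \<lbrakk>x \<in> carrier M; y \<in> carrier M; z \<in> carrier M\<rbrakk>
      \<Longrightarrow> (x \<otimes> y) \<otimes> z = x \<otimes> (y \<otimes> z)"
    and l_one: "\<And>x. x \<in> carrier M \<Longrightarrow> \<one> \<otimes> x = x"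
    and equiv: "equiv (carrier M) R"
    and cong_left: "\<And>x x' y. \<lbrakk>(x, x') \<in> R; y \<in> carrier M\<rbrakk> \<Longrightarrow> (x \<otimes> y, x' \<otimes> y) \<in> R"
    and comm: "\<And>x y. \<lbrakk>x \<in> carrier M; y \<in> carrier M\<rbrakk> \<Longrightarrow> (x \<otimes> y, y \<otimes> x) \<in> R"
    and inverse: "\<And>x. x \<in> carrier M \<Longrightarrow> \<exists>y\<in>carrier M. (x \<otimes> y, \<one>) \<in> R"
  shows "comm_group \<lparr>carrier = carrier M // R,
    mult = (\<lambda>X Y. \<Union>x\<in>X. \<Union>y\<in>Y. R `` {x \<otimes> y}), one = R `` {\<one>}\<rparr>" (is "comm_group ?Q")
proof -
  note eq_class = equiv_class_eq[OF equiv]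
  have R_closed: "x \<in> carrier M" "y \<in> carrier M" if "(x, y) \<in> R" for x y
    using that equiv_type[OF equiv] by auto
  have R_trans: "(x, z) \<in> R" if "(x, y) \<in> R" "(y, z) \<in> R" for x y z
    using equiv that by (auto elim!: equivE dest: transD)
  have "congruent2 R R (\<lambda>x y. R `` {x \<otimes> y})"
  proof (rule congruent2I[OF equiv equiv])
    show "R `` {x \<otimes> y} = R `` {x' \<otimes> y}" if "y \<in> carrier M" "(x, x') \<in> R" for x x' y
      using that by (intro eq_class cong_left)
    show "R `` {x \<otimes> y} = R `` {x \<otimes> y'}" if "x \<in> carrier M" "(y, y') \<in> R" for x y y'
      using that by (intro eq_class) (meson R_trans R_closed comm cong_left)
  qed
  then have mult: "R `` {x} \<otimes>\<^bsub>?Q\<^esub> R `` {y} = R `` {x \<otimes> y}" if "x \<in> carrier M" "y \<in> carrier M" for x y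
    using UN_equiv_class2[OF equiv equiv] that by simp
  have carrier: "carrier ?Q = carrier M // R" and one_eq: "\<one>\<^bsub>?Q\<^esub> = R `` {\<one>}"
    by simp_all
  note Q = carrier one_eq
  show ?thesis
  proof (rule comm_groupI)
    fix X Y assume "X \<in> carrier ?Q" "Y \<in> carrier ?Q"
    then obtain x y where [simp]: "x \<in> carrier M" "y \<in> carrier M" "X = R `` {x}" "Y = R `` {y}"
      unfolding Q by (auto elim!: quotientE)
    have "X \<otimes>\<^bsub>?Q\<^esub> Y = R `` {x \<otimes> y}"
      using mult[of x y] by simp
    then show "X \<otimes>\<^bsub>?Q\<^esub> Y \<in> carrier ?Q"
      unfolding Q by (simp add: quotientI closed)
  next
    show "\<one>\<^bsub>?Q\<^esub> \<in> carrier ?Q"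
      unfolding Q by (simp add: quotientI one)
  next
    fix X Y Z assume "X \<in> carrier ?Q" "Y \<in> carrier ?Q" "Z \<in> carrier ?Q"
    then obtain x y z where xyz: "x \<in> carrier M" "y \<in> carrier M" "z \<in> carrier M"
        "X = R `` {x}" "Y = R `` {y}" "Z = R `` {z}"
      unfolding Q by (auto elim!: quotientE)
    show "X \<otimes>\<^bsub>?Q\<^esub> Y \<otimes>\<^bsub>?Q\<^esub> Z = X \<otimes>\<^bsub>?Q\<^esub> (Y \<otimes>\<^bsub>?Q\<^esub> Z)"
      unfolding xyz by (simp only: mult xyz closed assoc)
  next
    fix X Y assume "X \<in> carrier ?Q" "Y \<in> carrier ?Q"
    then obtain x y where xy: "x \<in> carrier M" "y \<in> carrier M" "X = R `` {x}" "Y = R `` {y}"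
      unfolding Q by (auto elim!: quotientE)
    show "X \<otimes>\<^bsub>?Q\<^esub> Y = Y \<otimes>\<^bsub>?Q\<^esub> X"
      unfolding xy by (simp only: mult xy eq_class[OF comm])
  next
    fix X assume "X \<in> carrier ?Q"
    then obtain x where x: "x \<in> carrier M" "X = R `` {x}"
      unfolding Q by (auto elim!: quotientE)
    show "\<one>\<^bsub>?Q\<^esub> \<otimes>\<^bsub>?Q\<^esub> X = X"
      unfolding x one_eq by (simp only: mult x one l_one)
  next
    fix X assume "X \<in> carrier ?Q"
    then obtain x where x: "x \<in> carrier M" "X = R `` {x}"
      unfolding Q by (auto elim!: quotientE)
    from inverse[OF x(1)] obtain y where y: "y \<in> carrier M" "(x \<otimes> y, \<one>) \<in> R" by blast
    then have "(y \<otimes> x, \<one>) \<in> R"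
      using R_trans comm x(1) by blast
    then have "R `` {y} \<otimes>\<^bsub>?Q\<^esub> X = \<one>\<^bsub>?Q\<^esub>"
      unfolding x one_eq by (simp only: mult x y eq_class)
    moreover have "R `` {y} \<in> carrier ?Q"
      unfolding Q using y by (simp add: quotientI)
    ultimately show "\<exists>Y\<in>carrier ?Q. Y \<otimes>\<^bsub>?Q\<^esub> X = \<one>\<^bsub>?Q\<^esub>" by blast
  qed
qed


section \<open>Calculating in a crossed module\<close>

lemma (in group) cancel_inv_left:
  assumes "x \<in> carrier G" "y \<in> carrier G"
  shows "x \<otimes> (inv x \<otimes> y) = y" and "inv x \<otimes> (x \<otimes> y) = y"
  using assms by (simp_all flip: m_assoc)

text \<open>
  Turns an identity between two-letter words into one that rewrites inside a longer product
  bracketed to the right.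
\<close>
lemma (in monoid) mult_extend:
  assumes "x \<otimes> y = z \<otimes> w" "x \<in> carrier G" "y \<in> carrier G" "z \<in> carrier G" "w \<in> carrier G" "v \<in> carrier G"
  shows "x \<otimes> (y \<otimes> v) = z \<otimes> (w \<otimes> v)"
  using assms by (simp flip: m_assoc)

context left_aut_action
begin

lemma act_group_hom: "\<sigma> \<in> carrier \<Gamma> \<Longrightarrow> group_hom A A (act \<sigma>)"
  by (simp add: group_hom_def group_hom_axioms_def act_hom)

lemma act_closed [simp]: "\<lbrakk>\<sigma> \<in> carrier \<Gamma>; a \<in> carrier A\<rbrakk> \<Longrightarrow> act \<sigma> a \<in> carrier A"
  using group_hom.hom_closed[OF act_group_hom] .

lemma act_distrib: "\<lbrakk>\<sigma> \<in> carrier \<Gamma>; a \<in> carrier A; b \<in> carrier A\<rbrakk>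
    \<Longrightarrow> act \<sigma> (a \<otimes>\<^bsub>A\<^esub> b) = act \<sigma> a \<otimes>\<^bsub>A\<^esub> act \<sigma> b"
  using group_hom.hom_mult[OF act_group_hom] .

lemma act_inv: "\<lbrakk>\<sigma> \<in> carrier \<Gamma>; a \<in> carrier A\<rbrakk> \<Longrightarrow> act \<sigma> (inv\<^bsub>A\<^esub> a) = inv\<^bsub>A\<^esub> act \<sigma> a"
  using group_hom.hom_inv[OF act_group_hom] .

lemma act_unit: "\<sigma> \<in> carrier \<Gamma> \<Longrightarrow> act \<sigma> \<one>\<^bsub>A\<^esub> = \<one>\<^bsub>A\<^esub>"
  using group_hom.hom_one[OF act_group_hom] .

end

context crossed_module
begin

abbreviation mult1 (infixl "\<cdot>" 70) where "x \<cdot> y \<equiv> x \<otimes>\<^bsub>G1\<^esub> y"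
abbreviation mult0 (infixl "\<bullet>" 76) where "x \<bullet> y \<equiv> x \<otimes>\<^bsub>G0\<^esub> y"
abbreviation inv1 where "inv1 x \<equiv> inv\<^bsub>G1\<^esub> x"
abbreviation inv0 where "inv0 x \<equiv> inv\<^bsub>G0\<^esub> x"

lemma ract_group_hom: "g \<in> carrier G0 \<Longrightarrow> group_hom G1 G1 (\<lambda>\<alpha>. \<alpha> \<triangleleft> g)"
  by (simp add: group_hom_def group_hom_axioms_def ract.ract_hom bd.G.group_axioms)

lemma ract_closed [simp]: "\<lbrakk>\<alpha> \<in> carrier G1; g \<in> carrier G0\<rbrakk> \<Longrightarrow> \<alpha> \<triangleleft> g \<in> carrier G1"
  using group_hom.hom_closed[OF ract_group_hom] by fast

lemma ract_distrib: "\<lbrakk>\<alpha> \<in> carrier G1; \<beta> \<in> carrier G1; g \<in> carrier G0\<rbrakk> \<Longrightarrow> (\<alpha> \<cdot> \<beta>) \<triangleleft> g = (\<alpha> \<triangleleft> g) \<cdot> (\<beta> \<triangleleft> g)"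
  using group_hom.hom_mult[OF ract_group_hom] by fast

lemma ract_inv: "\<lbrakk>\<alpha> \<in> carrier G1; g \<in> carrier G0\<rbrakk> \<Longrightarrow> inv1 \<alpha> \<triangleleft> g = inv1 (\<alpha> \<triangleleft> g)"
  using group_hom.hom_inv[OF ract_group_hom] by fast

lemma ract_unit: "g \<in> carrier G0 \<Longrightarrow> \<one>\<^bsub>G1\<^esub> \<triangleleft> g = \<one>\<^bsub>G1\<^esub>"
  using group_hom.hom_one[OF ract_group_hom] by fast

text \<open>
  The normal form used throughout: words in \<open>G1\<close> bracketed to the right, whose letters carry
  all inverses outside of the action and a single exponent from \<open>G0\<close>.
\<close>
lemmas ract_simps = ract_distrib ract_inv ract_unit ract.ract_one
  ract.ract_mult[symmetric] bd.G.inv_mult_group bd.G.m_assoc bd.H.m_assoc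
  bd.G.cancel_inv_left bd.H.cancel_inv_left bd.H.inv_mult_group

text \<open>
  Interchange: for \<open>\<alpha> : u \<rightarrow> v\<close> and any morphism \<open>\<xi>\<close>, composing \<open>\<xi> \<triangleleft> u\<close> with \<open>\<alpha>\<close> or \<open>\<alpha>\<close> with
  \<open>\<xi> \<triangleleft> v\<close> gives the same result. The lemma \<open>br_slide\<close> is the case \<open>\<alpha> = br g h\<close>.
\<close>
lemma slide:
  assumes "u \<bullet> bd \<alpha> = v" "\<alpha> \<in> carrier G1" "\<xi> \<in> carrier G1" "u \<in> carrier G0"
  shows "\<alpha> \<cdot> (\<xi> \<triangleleft> v) = (\<xi> \<triangleleft> u) \<cdot> \<alpha>"
proof -
  have "\<xi> \<triangleleft> v = (\<xi> \<triangleleft> u) \<triangleleft> bd \<alpha>"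
    using assms by (simp add: ract.ract_mult flip: assms(1))
  also have "\<dots> = inv1 \<alpha> \<cdot> (\<xi> \<triangleleft> u) \<cdot> \<alpha>"
    using assms by (simp add: ract_bd)
  finally show ?thesis
    using assms(2-) by (simp add: ract_simps)
qed


text \<open>
  The next two identities describe the inverse and the composite of isomorphisms of cocycles,
  evaluated at a pair \<open>(\<sigma>, \<tau>)\<close>. Here \<open>bi\<close> stands for \<open>\<sigma>(pi \<tau>)\<close>, \<open>E1\<close> for \<open>\<epsilon>1 (\<sigma>, \<tau>)\<close>, and
  \<open>Ta\<close>, \<open>Tb\<close>, \<open>Ts\<close> for \<open>\<theta> \<sigma>\<close>, \<open>\<sigma>(\<theta> \<tau>)\<close>, \<open>\<theta> (\<sigma>\<tau>)\<close>; likewise \<open>Fa\<close>, \<open>Fb\<close>, \<open>Fs\<close> for a second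
  isomorphism. In the first identity \<open>h = \<sigma>g\<close> and \<open>k = (\<sigma>\<tau>)g\<close> come from the object of the
  isomorphism; in the second \<open>k = (\<sigma>\<tau>)g\<close> comes from the first isomorphism, while \<open>h\<close> and \<open>l\<close>
  are the translates by \<open>\<sigma>\<close> and \<open>\<sigma>\<tau>\<close> of the object of the second.
\<close>
lemma iso_sym_identity:
  assumes [simp]: "b1 \<in> carrier G0" "h \<in> carrier G0" "k \<in> carrier G0" "E1 \<in> carrier G1"
      "Ta \<in> carrier G1" "Tb \<in> carrier G1" "Ts \<in> carrier G1"
    and b2: "b2 = inv0 h \<bullet> b1 \<bullet> k \<bullet> inv0 (bd Tb)"
    and E2: "E2 = Ts \<cdot> (E1 \<triangleleft> k) \<cdot> inv1 Tb \<cdot> (inv1 Ta \<triangleleft> b2)"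
  shows "E1 = (inv1 Ts \<triangleleft> inv0 k) \<cdot> (E2 \<triangleleft> inv0 k) \<cdot> inv1 (inv1 Tb \<triangleleft> inv0 k)
    \<cdot> (inv1 (inv1 Ta \<triangleleft> inv0 h) \<triangleleft> b1)"
proof -
  have b2_closed [simp]: "b2 \<in> carrier G0"
    by (simp add: b2)
  have "(Tb \<triangleleft> inv0 k) \<cdot> (Ta \<triangleleft> inv0 h \<bullet> b1) = (Ta \<triangleleft> b2 \<bullet> inv0 k) \<cdot> (Tb \<triangleleft> inv0 k)"
    by (rule slide) (simp_all add: b2 bd_ract ract_simps)
  then show ?thesis
    by (simp add: E2 ract_simps)
qed

lemma iso_trans_identity:
  assumes [simp]: "b2 \<in> carrier G0" "h \<in> carrier G0" "k \<in> carrier G0" "l \<in> carrier G0" "E1 \<in> carrier G1"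
      "Ta \<in> carrier G1" "Tb \<in> carrier G1" "Ts \<in> carrier G1"
      "Fa \<in> carrier G1" "Fb \<in> carrier G1" "Fs \<in> carrier G1"
    and b3: "b3 = inv0 h \<bullet> b2 \<bullet> l \<bullet> inv0 (bd Fb)"
  shows "Fs \<cdot> ((Ts \<cdot> (E1 \<triangleleft> k) \<cdot> inv1 Tb \<cdot> (inv1 Ta \<triangleleft> b2)) \<triangleleft> l) \<cdot> inv1 Fb \<cdot> (inv1 Fa \<triangleleft> b3)
    = (Fs \<cdot> (Ts \<triangleleft> l)) \<cdot> (E1 \<triangleleft> k \<bullet> l) \<cdot> inv1 (Fb \<cdot> (Tb \<triangleleft> l)) \<cdot> (inv1 (Fa \<cdot> (Ta \<triangleleft> h)) \<triangleleft> b3)"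
proof -
  have b3_closed [simp]: "b3 \<in> carrier G0"
    by (simp add: b3)
  have "inv1 Fb \<cdot> (inv1 Ta \<triangleleft> h \<bullet> b3) = (inv1 Ta \<triangleleft> b2 \<bullet> l) \<cdot> inv1 Fb"
    by (rule slide) (simp_all add: b3 ract_simps)
  then have "inv1 Fb \<cdot> inv1 (Ta \<triangleleft> h \<bullet> b3) = inv1 (Ta \<triangleleft> b2 \<bullet> l) \<cdot> inv1 Fb"
    by (simp add: ract_inv)
  from this[THEN bd.G.mult_extend] show ?thesis
    by (simp add: ract_simps)
qed

end

context equivariant_crossed_module
begin

section \<open>Isomorphism of cocycles is an equivalence relation\<close>

lemma Z1_iff:
  "(p, \<epsilon>) \<in> Z1 \<longleftrightarrow>
     p \<in> carrier \<Gamma> \<rightarrow>\<^sub>E carrier G0 \<and> p \<one>\<^bsub>\<Gamma>\<^esub> = \<one>\<^bsub>G0\<^esub> \<and>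
     \<epsilon> \<in> carrier \<Gamma> \<times> carrier \<Gamma> \<rightarrow>\<^sub>E carrier G1 \<and> \<epsilon> (\<one>\<^bsub>\<Gamma>\<^esub>, \<one>\<^bsub>\<Gamma>\<^esub>) = \<one>\<^bsub>G1\<^esub> \<and>
     (\<forall>\<sigma>\<in>carrier \<Gamma>. \<forall>\<tau>\<in>carrier \<Gamma>.
        p (\<sigma> \<otimes>\<^bsub>\<Gamma>\<^esub> \<tau>) \<bullet> bd (\<epsilon> (\<sigma>, \<tau>)) = p \<sigma> \<bullet> act0 \<sigma> (p \<tau>)) \<and>
     (\<forall>\<sigma>\<in>carrier \<Gamma>. \<forall>\<tau>\<in>carrier \<Gamma>. \<forall>\<upsilon>\<in>carrier \<Gamma>.
        \<epsilon> (\<sigma>, \<tau> \<otimes>\<^bsub>\<Gamma>\<^esub> \<upsilon>) \<cdot> act1 \<sigma> (\<epsilon> (\<tau>, \<upsilon>)) =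
        \<epsilon> (\<sigma> \<otimes>\<^bsub>\<Gamma>\<^esub> \<tau>, \<upsilon>) \<cdot> (\<epsilon> (\<sigma>, \<tau>) \<triangleleft> act0 (\<sigma> \<otimes>\<^bsub>\<Gamma>\<^esub> \<tau>) (p \<upsilon>)))"
  by (simp add: Z1_def)

lemma Z1_closed:
  assumes "(p, \<epsilon>) \<in> Z1"
  shows "\<sigma> \<in> carrier \<Gamma> \<Longrightarrow> p \<sigma> \<in> carrier G0"
    and "\<lbrakk>\<sigma> \<in> carrier \<Gamma>; \<tau> \<in> carrier \<Gamma>\<rbrakk> \<Longrightarrow> \<epsilon> (\<sigma>, \<tau>) \<in> carrier G1"
  using assms by (auto simp: Z1_iff PiE_mem)

lemma Z1_boundary:
  assumes "(p, \<epsilon>) \<in> Z1" "\<sigma> \<in> carrier \<Gamma>" "\<tau> \<in> carrier \<Gamma>"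
  shows "p (\<sigma> \<otimes>\<^bsub>\<Gamma>\<^esub> \<tau>) \<bullet> bd (\<epsilon> (\<sigma>, \<tau>)) = p \<sigma> \<bullet> act0 \<sigma> (p \<tau>)"
  using assms by (auto simp: Z1_iff)

lemma cochain_eqI:
  assumes "p \<in> extensional (carrier \<Gamma>)" "q \<in> extensional (carrier \<Gamma>)"
    and "\<epsilon> \<in> extensional (carrier \<Gamma> \<times> carrier \<Gamma>)" "\<delta> \<in> extensional (carrier \<Gamma> \<times> carrier \<Gamma>)"
    and "\<And>\<sigma>. \<sigma> \<in> carrier \<Gamma> \<Longrightarrow> p \<sigma> = q \<sigma>"
    and "\<And>\<sigma> \<tau>. \<lbrakk>\<sigma> \<in> carrier \<Gamma>; \<tau> \<in> carrier \<Gamma>\<rbrakk> \<Longrightarrow> \<epsilon> (\<sigma>, \<tau>) = \<delta> (\<sigma>, \<tau>)"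
  shows "(p, \<epsilon>) = (q, \<delta>)"
proof -
  have "p = q"
    using assms(1,2,5) by (rule extensionalityI)
  moreover have "\<epsilon> = \<delta>"
    using assms(3,4) by (rule extensionalityI) (auto simp: assms(6))
  ultimately show ?thesis
    by simp
qed

lemma cocycle_isoI:
  assumes "(p1, \<epsilon>1) \<in> Z1" "(p2, \<epsilon>2) \<in> Z1"
    and "g \<in> carrier G0" "\<And>\<sigma>. \<sigma> \<in> carrier \<Gamma> \<Longrightarrow> \<theta> \<sigma> \<in> carrier G1" "\<theta> \<one>\<^bsub>\<Gamma>\<^esub> = \<one>\<^bsub>G1\<^esub>"
    and "\<And>\<sigma>. \<sigma> \<in> carrier \<Gamma> \<Longrightarrow> p2 \<sigma> = inv0 g \<bullet> p1 \<sigma> \<bullet> act0 \<sigma> g \<bullet> inv0 (bd (\<theta> \<sigma>))"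
    and "\<And>\<sigma> \<tau>. \<lbrakk>\<sigma> \<in> carrier \<Gamma>; \<tau> \<in> carrier \<Gamma>\<rbrakk> \<Longrightarrow> \<epsilon>2 (\<sigma>, \<tau>) =
      \<theta> (\<sigma> \<otimes>\<^bsub>\<Gamma>\<^esub> \<tau>) \<cdot> (\<epsilon>1 (\<sigma>, \<tau>) \<triangleleft> act0 (\<sigma> \<otimes>\<^bsub>\<Gamma>\<^esub> \<tau>) g) \<cdot> inv1 (act1 \<sigma> (\<theta> \<tau>))
        \<cdot> (inv1 (\<theta> \<sigma>) \<triangleleft> act0 \<sigma> (p2 \<tau>))"
  shows "((p1, \<epsilon>1), (p2, \<epsilon>2)) \<in> cocycle_iso"
  using assms by (auto simp: cocycle_iso_def intro!: bexI[of _ g] bexI[of _ \<theta>])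

lemma cocycle_isoE:
  assumes "((p1, \<epsilon>1), (p2, \<epsilon>2)) \<in> cocycle_iso"
  obtains g \<theta> where "(p1, \<epsilon>1) \<in> Z1" "(p2, \<epsilon>2) \<in> Z1"
    and "g \<in> carrier G0" "\<And>\<sigma>. \<sigma> \<in> carrier \<Gamma> \<Longrightarrow> \<theta> \<sigma> \<in> carrier G1" "\<theta> \<one>\<^bsub>\<Gamma>\<^esub> = \<one>\<^bsub>G1\<^esub>"
    and "\<And>\<sigma>. \<sigma> \<in> carrier \<Gamma> \<Longrightarrow> p2 \<sigma> = inv0 g \<bullet> p1 \<sigma> \<bullet> act0 \<sigma> g \<bullet> inv0 (bd (\<theta> \<sigma>))"
    and "\<And>\<sigma> \<tau>. \<lbrakk>\<sigma> \<in> carrier \<Gamma>; \<tau> \<in> carrier \<Gamma>\<rbrakk> \<Longrightarrow> \<epsilon>2 (\<sigma>, \<tau>) =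
      \<theta> (\<sigma> \<otimes>\<^bsub>\<Gamma>\<^esub> \<tau>) \<cdot> (\<epsilon>1 (\<sigma>, \<tau>) \<triangleleft> act0 (\<sigma> \<otimes>\<^bsub>\<Gamma>\<^esub> \<tau>) g) \<cdot> inv1 (act1 \<sigma> (\<theta> \<tau>))
        \<cdot> (inv1 (\<theta> \<sigma>) \<triangleleft> act0 \<sigma> (p2 \<tau>))"
proof -
  from assms obtain g \<theta> where *: "(p1, \<epsilon>1) \<in> Z1" "(p2, \<epsilon>2) \<in> Z1"
    "g \<in> carrier G0" "\<theta> \<in> carrier \<Gamma> \<rightarrow> carrier G1" "\<theta> \<one>\<^bsub>\<Gamma>\<^esub> = \<one>\<^bsub>G1\<^esub>"
    "\<forall>\<sigma>\<in>carrier \<Gamma>. p2 \<sigma> = inv0 g \<bullet> p1 \<sigma> \<bullet> act0 \<sigma> g \<bullet> inv0 (bd (\<theta> \<sigma>))"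
    "\<forall>\<sigma>\<in>carrier \<Gamma>. \<forall>\<tau>\<in>carrier \<Gamma>. \<epsilon>2 (\<sigma>, \<tau>) =
      \<theta> (\<sigma> \<otimes>\<^bsub>\<Gamma>\<^esub> \<tau>) \<cdot> (\<epsilon>1 (\<sigma>, \<tau>) \<triangleleft> act0 (\<sigma> \<otimes>\<^bsub>\<Gamma>\<^esub> \<tau>) g) \<cdot> inv1 (act1 \<sigma> (\<theta> \<tau>))
        \<cdot> (inv1 (\<theta> \<sigma>) \<triangleleft> act0 \<sigma> (p2 \<tau>))"
    unfolding cocycle_iso_def by blast
  show thesis
    by (rule that[of g \<theta>]) (use * in \<open>simp_all add: Pi_iff\<close>)
qed

lemma equiv_cocycle_iso: "equiv Z1 cocycle_iso"
proof (rule equivI)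
  show "cocycle_iso \<subseteq> Z1 \<times> Z1"
    by (auto simp: cocycle_iso_def)
  show "refl_on Z1 cocycle_iso"
  proof (rule refl_onI)
    fix x assume "x \<in> Z1"
    obtain p \<epsilon> where x: "x = (p, \<epsilon>)" by force
    with \<open>x \<in> Z1\<close> have "(p, \<epsilon>) \<in> Z1" by simp
    note [simp] = Z1_closed[OF this]
    show "(x, x) \<in> cocycle_iso"
      unfolding x
      by (rule cocycle_isoI[of _ _ _ _ "\<one>\<^bsub>G0\<^esub>" "\<lambda>_. \<one>\<^bsub>G1\<^esub>"])
        (simp_all add: \<open>(p, \<epsilon>) \<in> Z1\<close> ract_simps act0.act_unit act1.act_unit)
  qed
  show "sym cocycle_iso"
  proof (rule symI)
    fix x y assume xy: "(x, y) \<in> cocycle_iso"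
    obtain p1 \<epsilon>1 p2 \<epsilon>2 where x: "x = (p1, \<epsilon>1)" and y: "y = (p2, \<epsilon>2)" by force
    from xy obtain g \<theta> where 1: "(p1, \<epsilon>1) \<in> Z1" and 2: "(p2, \<epsilon>2) \<in> Z1"
      and [simp]: "g \<in> carrier G0" "\<And>\<sigma>. \<sigma> \<in> carrier \<Gamma> \<Longrightarrow> \<theta> \<sigma> \<in> carrier G1" "\<theta> \<one>\<^bsub>\<Gamma>\<^esub> = \<one>\<^bsub>G1\<^esub>"
      and p2: "\<And>\<sigma>. \<sigma> \<in> carrier \<Gamma> \<Longrightarrow> p2 \<sigma> = inv0 g \<bullet> p1 \<sigma> \<bullet> act0 \<sigma> g \<bullet> inv0 (bd (\<theta> \<sigma>))"
      and \<epsilon>2: "\<And>\<sigma> \<tau>. \<lbrakk>\<sigma> \<in> carrier \<Gamma>; \<tau> \<in> carrier \<Gamma>\<rbrakk> \<Longrightarrow> \<epsilon>2 (\<sigma>, \<tau>) =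
        \<theta> (\<sigma> \<otimes>\<^bsub>\<Gamma>\<^esub> \<tau>) \<cdot> (\<epsilon>1 (\<sigma>, \<tau>) \<triangleleft> act0 (\<sigma> \<otimes>\<^bsub>\<Gamma>\<^esub> \<tau>) g) \<cdot> inv1 (act1 \<sigma> (\<theta> \<tau>))
          \<cdot> (inv1 (\<theta> \<sigma>) \<triangleleft> act0 \<sigma> (p2 \<tau>))"
      unfolding x y by (rule cocycle_isoE) blast
    note [simp] = Z1_closed[OF 1] Z1_closed[OF 2]
    show "(y, x) \<in> cocycle_iso"
      unfolding x y
    proof (rule cocycle_isoI[of _ _ _ _ "inv0 g" "\<lambda>\<sigma>. inv1 (\<theta> \<sigma>) \<triangleleft> inv0 (act0 \<sigma> g)", OF 2 1])
      fix \<sigma> \<tau> assume [simp]: "\<sigma> \<in> carrier \<Gamma>" "\<tau> \<in> carrier \<Gamma>"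
      have "act0 \<sigma> (p2 \<tau>) = inv0 (act0 \<sigma> g) \<bullet> act0 \<sigma> (p1 \<tau>) \<bullet> act0 (\<sigma> \<otimes>\<^bsub>\<Gamma>\<^esub> \<tau>) g \<bullet> inv0 (bd (act1 \<sigma> (\<theta> \<tau>)))"
        by (simp add: p2 act0.act_distrib act0.act_inv act0.act_mult bd_act)
      from iso_sym_identity[OF _ _ _ _ _ _ _ this \<epsilon>2]
      show "\<epsilon>1 (\<sigma>, \<tau>) = (inv1 (\<theta> (\<sigma> \<otimes>\<^bsub>\<Gamma>\<^esub> \<tau>)) \<triangleleft> inv0 (act0 (\<sigma> \<otimes>\<^bsub>\<Gamma>\<^esub> \<tau>) g))
          \<cdot> (\<epsilon>2 (\<sigma>, \<tau>) \<triangleleft> act0 (\<sigma> \<otimes>\<^bsub>\<Gamma>\<^esub> \<tau>) (inv0 g)) \<cdot> inv1 (act1 \<sigma> (inv1 (\<theta> \<tau>) \<triangleleft> inv0 (act0 \<tau> g)))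
          \<cdot> (inv1 (inv1 (\<theta> \<sigma>) \<triangleleft> inv0 (act0 \<sigma> g)) \<triangleleft> act0 \<sigma> (p1 \<tau>))"
        by (simp add: act0.act_inv act1.act_inv act_ract act0.act_mult)
    qed (simp_all add: p2 bd_ract ract_simps ract_unit act0.act_inv)
  qed
  show "trans cocycle_iso"
  proof (rule transI)
    fix x y z assume xy: "(x, y) \<in> cocycle_iso" and yz: "(y, z) \<in> cocycle_iso"
    obtain p1 \<epsilon>1 p2 \<epsilon>2 p3 \<epsilon>3
      where x: "x = (p1, \<epsilon>1)" and y: "y = (p2, \<epsilon>2)" and z: "z = (p3, \<epsilon>3)" by force
    from xy obtain g \<theta> where 1: "(p1, \<epsilon>1) \<in> Z1" and 2: "(p2, \<epsilon>2) \<in> Z1"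
      and [simp]: "g \<in> carrier G0" "\<And>\<sigma>. \<sigma> \<in> carrier \<Gamma> \<Longrightarrow> \<theta> \<sigma> \<in> carrier G1" "\<theta> \<one>\<^bsub>\<Gamma>\<^esub> = \<one>\<^bsub>G1\<^esub>"
      and p2: "\<And>\<sigma>. \<sigma> \<in> carrier \<Gamma> \<Longrightarrow> p2 \<sigma> = inv0 g \<bullet> p1 \<sigma> \<bullet> act0 \<sigma> g \<bullet> inv0 (bd (\<theta> \<sigma>))"
      and \<epsilon>2: "\<And>\<sigma> \<tau>. \<lbrakk>\<sigma> \<in> carrier \<Gamma>; \<tau> \<in> carrier \<Gamma>\<rbrakk> \<Longrightarrow> \<epsilon>2 (\<sigma>, \<tau>) =
        \<theta> (\<sigma> \<otimes>\<^bsub>\<Gamma>\<^esub> \<tau>) \<cdot> (\<epsilon>1 (\<sigma>, \<tau>) \<triangleleft> act0 (\<sigma> \<otimes>\<^bsub>\<Gamma>\<^esub> \<tau>) g) \<cdot> inv1 (act1 \<sigma> (\<theta> \<tau>))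
          \<cdot> (inv1 (\<theta> \<sigma>) \<triangleleft> act0 \<sigma> (p2 \<tau>))"
      unfolding x y by (rule cocycle_isoE) blast
    from yz obtain h \<phi> where 3: "(p3, \<epsilon>3) \<in> Z1"
      and [simp]: "h \<in> carrier G0" "\<And>\<sigma>. \<sigma> \<in> carrier \<Gamma> \<Longrightarrow> \<phi> \<sigma> \<in> carrier G1" "\<phi> \<one>\<^bsub>\<Gamma>\<^esub> = \<one>\<^bsub>G1\<^esub>"
      and p3: "\<And>\<sigma>. \<sigma> \<in> carrier \<Gamma> \<Longrightarrow> p3 \<sigma> = inv0 h \<bullet> p2 \<sigma> \<bullet> act0 \<sigma> h \<bullet> inv0 (bd (\<phi> \<sigma>))"
      and \<epsilon>3: "\<And>\<sigma> \<tau>. \<lbrakk>\<sigma> \<in> carrier \<Gamma>; \<tau> \<in> carrier \<Gamma>\<rbrakk> \<Longrightarrow> \<epsilon>3 (\<sigma>, \<tau>) =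
        \<phi> (\<sigma> \<otimes>\<^bsub>\<Gamma>\<^esub> \<tau>) \<cdot> (\<epsilon>2 (\<sigma>, \<tau>) \<triangleleft> act0 (\<sigma> \<otimes>\<^bsub>\<Gamma>\<^esub> \<tau>) h) \<cdot> inv1 (act1 \<sigma> (\<phi> \<tau>))
          \<cdot> (inv1 (\<phi> \<sigma>) \<triangleleft> act0 \<sigma> (p3 \<tau>))"
      unfolding y z by (rule cocycle_isoE) blast
    note [simp] = Z1_closed[OF 1] Z1_closed[OF 2] Z1_closed[OF 3]
    show "(x, z) \<in> cocycle_iso"
      unfolding x z
    proof (rule cocycle_isoI[of _ _ _ _ "g \<bullet> h" "\<lambda>\<sigma>. \<phi> \<sigma> \<cdot> (\<theta> \<sigma> \<triangleleft> act0 \<sigma> h)", OF 1 3])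
      fix \<sigma> \<tau> assume [simp]: "\<sigma> \<in> carrier \<Gamma>" "\<tau> \<in> carrier \<Gamma>"
      have "act0 \<sigma> (p3 \<tau>) = inv0 (act0 \<sigma> h) \<bullet> act0 \<sigma> (p2 \<tau>) \<bullet> act0 (\<sigma> \<otimes>\<^bsub>\<Gamma>\<^esub> \<tau>) h \<bullet> inv0 (bd (act1 \<sigma> (\<phi> \<tau>)))"
        by (simp add: p3 act0.act_distrib act0.act_inv act0.act_mult bd_act)
      note identity = iso_trans_identity[OF _ _ _ _ _ _ _ _ _ _ _ this]
      show "\<epsilon>3 (\<sigma>, \<tau>) = \<phi> (\<sigma> \<otimes>\<^bsub>\<Gamma>\<^esub> \<tau>) \<cdot> (\<theta> (\<sigma> \<otimes>\<^bsub>\<Gamma>\<^esub> \<tau>) \<triangleleft> act0 (\<sigma> \<otimes>\<^bsub>\<Gamma>\<^esub> \<tau>) h)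
          \<cdot> (\<epsilon>1 (\<sigma>, \<tau>) \<triangleleft> act0 (\<sigma> \<otimes>\<^bsub>\<Gamma>\<^esub> \<tau>) (g \<bullet> h)) \<cdot> inv1 (act1 \<sigma> (\<phi> \<tau> \<cdot> (\<theta> \<tau> \<triangleleft> act0 \<tau> h)))
          \<cdot> (inv1 (\<phi> \<sigma> \<cdot> (\<theta> \<sigma> \<triangleleft> act0 \<sigma> h)) \<triangleleft> act0 \<sigma> (p3 \<tau>))"
        by (simp only: \<epsilon>3 \<epsilon>2 \<open>\<sigma> \<in> carrier \<Gamma>\<close> \<open>\<tau> \<in> carrier \<Gamma>\<close>, subst identity)
          (simp_all add: act0.act_distrib act1.act_distrib act_ract act0.act_mult)
    qed (simp_all add: p2 p3 bd_ract ract_simps ract_unit act0.act_distrib)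
  qed
qed

end

context braided_equivariant_crossed_module
begin

section \<open>Coherence identities for the braiding\<close>

declare br_closed [simp]

lemma br_slide:
  assumes "g \<in> carrier G0" "h \<in> carrier G0" "\<xi> \<in> carrier G1"
  shows "br g h \<cdot> (\<xi> \<triangleleft> g \<bullet> h) = (\<xi> \<triangleleft> h \<bullet> g) \<cdot> br g h"
  using assms by (intro slide) (simp_all add: bd_br ract_simps)

text \<open>
  Naturality of the braiding in each argument: a morphism \<open>s \<rightarrow> r\<close> may be applied before or after
  the crossing.
\<close>
lemma br_nat_left:
  assumes "s \<bullet> bd \<alpha> = r" "\<alpha> \<in> carrier G1" "s \<in> carrier G0" "c \<in> carrier G0"
  shows "br s c \<cdot> (\<alpha> \<triangleleft> c) = \<alpha> \<cdot> br r c"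
proof -
  have "br r c = inv1 \<alpha> \<cdot> br s c \<cdot> \<alpha> \<cdot> (inv1 \<alpha> \<cdot> (\<alpha> \<triangleleft> c))"
    using assms(2-) by (simp add: br_mult_left ract_bd br_bd_left flip: assms(1))
  with assms(2-) show ?thesis by (simp add: ract_simps)
qed

lemma br_nat_right:
  assumes "t \<bullet> bd \<beta> = r" "\<beta> \<in> carrier G1" "t \<in> carrier G0" "a \<in> carrier G0"
  shows "br a t \<cdot> \<beta> = (\<beta> \<triangleleft> a) \<cdot> br a r"
proof -
  have "br a r = (inv1 \<beta> \<triangleleft> a) \<cdot> \<beta> \<cdot> (inv1 \<beta> \<cdot> br a t \<cdot> \<beta>)"
    using assms(2-) by (simp add: br_mult_right ract_bd br_bd_right flip: assms(1))
  with assms(2-) show ?thesis by (simp add: ract_simps)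
qed


text \<open>
  In the identities of this section an index \<open>i\<close> refers to a cochain \<open>(pi, \<epsilon>i)\<close>, and the letters are
  \<open>ai = pi \<sigma>\<close>, \<open>bi = \<sigma>(pi \<tau>)\<close>, \<open>ci = (\<sigma>\<tau>)(pi \<upsilon>)\<close>, \<open>si = pi (\<sigma>\<tau>)\<close>, \<open>ti = \<sigma>(pi (\<tau>\<upsilon>))\<close>,
  \<open>ui = pi (\<sigma>\<tau>\<upsilon>)\<close>, and \<open>Ai = \<epsilon>i (\<sigma>, \<tau>\<upsilon>)\<close>, \<open>Bi = \<sigma>(\<epsilon>i (\<tau>, \<upsilon>))\<close>, \<open>Ci = \<epsilon>i (\<sigma>\<tau>, \<upsilon>)\<close>,
  \<open>Ei = \<epsilon>i (\<sigma>, \<tau>)\<close>.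

  The boundary condition of a product is that of the first factor, followed by that of the second
  one, followed by a fixed word \<open>?W\<close>; the outer two cancel.
\<close>
lemma mult_boundary_iff:
  assumes [simp]: "a1 \<in> carrier G0" "b1 \<in> carrier G0" "s1 \<in> carrier G0" "E1 \<in> carrier G1"
      "a2 \<in> carrier G0" "b2 \<in> carrier G0" "s2 \<in> carrier G0" "E2 \<in> carrier G1"
    and E1: "s1 \<bullet> bd E1 = a1 \<bullet> b1"
  shows "s1 \<bullet> s2 \<bullet> bd ((E1 \<triangleleft> s2) \<cdot> E2 \<cdot> (br a2 b1 \<triangleleft> b2)) = a1 \<bullet> a2 \<bullet> (b1 \<bullet> b2)
    \<longleftrightarrow> s2 \<bullet> bd E2 = a2 \<bullet> b2"
proof -
  let ?W = "inv0 b2 \<bullet> inv0 a2 \<bullet> inv0 b1 \<bullet> a2 \<bullet> b1 \<bullet> b2"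
  have "s1 \<bullet> s2 \<bullet> bd ((E1 \<triangleleft> s2) \<cdot> E2 \<cdot> (br a2 b1 \<triangleleft> b2)) = s1 \<bullet> bd E1 \<bullet> (s2 \<bullet> bd E2) \<bullet> ?W"
    by (simp add: bd_ract bd_br ract_simps)
  moreover have "a1 \<bullet> a2 \<bullet> (b1 \<bullet> b2) = a1 \<bullet> b1 \<bullet> (a2 \<bullet> b2) \<bullet> ?W"
    by (simp add: ract_simps)
  ultimately show ?thesis
    by (simp add: E1)
qed

text \<open>
  Both sides of the cocycle identity of a product factor as \<open>?K\<close>, then the corresponding side of the
  identity for the second factor, then \<open>?Z\<close>. The word \<open>?K\<close> is the common value of
  the identity for the first factor, acted on by \<open>u2\<close>, and \<open>?Z\<close> collects the crossings. That the
  crossings agree follows by interchange from the hexagon laws, which expand \<open>br a2 (b1 \<bullet> c1)\<close> on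
  one side and \<open>br (a2 \<bullet> b2) c1\<close> on the other. Cancelling \<open>?K\<close> and \<open>?Z\<close> leaves the second identity.
\<close>
lemma mult_cocycle_iff:
  assumes [simp]: "b1 \<in> carrier G0" "c1 \<in> carrier G0" "t1 \<in> carrier G0"
      "A1 \<in> carrier G1" "B1 \<in> carrier G1" "C1 \<in> carrier G1" "E1 \<in> carrier G1"
      "a2 \<in> carrier G0" "b2 \<in> carrier G0" "c2 \<in> carrier G0" "s2 \<in> carrier G0" "t2 \<in> carrier G0" "u2 \<in> carrier G0"
      "A2 \<in> carrier G1" "B2 \<in> carrier G1" "C2 \<in> carrier G1" "E2 \<in> carrier G1"
    and B1: "t1 \<bullet> bd B1 = b1 \<bullet> c1"
    and E2: "s2 \<bullet> bd E2 = a2 \<bullet> b2" and B2: "t2 \<bullet> bd B2 = b2 \<bullet> c2"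
    and A2: "u2 \<bullet> bd A2 = a2 \<bullet> t2" and C2: "u2 \<bullet> bd C2 = s2 \<bullet> c2"
    and cocycle1: "A1 \<cdot> B1 = C1 \<cdot> (E1 \<triangleleft> c1)"
  shows "((A1 \<triangleleft> u2) \<cdot> A2 \<cdot> (br a2 t1 \<triangleleft> t2)) \<cdot> ((B1 \<triangleleft> t2) \<cdot> B2 \<cdot> (br b2 c1 \<triangleleft> c2))
      = ((C1 \<triangleleft> u2) \<cdot> C2 \<cdot> (br s2 c1 \<triangleleft> c2)) \<cdot> (((E1 \<triangleleft> s2) \<cdot> E2 \<cdot> (br a2 b1 \<triangleleft> b2)) \<triangleleft> c1 \<bullet> c2)
    \<longleftrightarrow> A2 \<cdot> B2 = C2 \<cdot> (E2 \<triangleleft> c2)" (is "?L = ?R \<longleftrightarrow> _")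
proof -
  let ?K = "(A1 \<cdot> B1) \<triangleleft> u2" and ?Z = "(br a2 (b1 \<bullet> c1) \<triangleleft> b2 \<bullet> c2) \<cdot> (br b2 c1 \<triangleleft> c2)"
  have "?L = ?K \<cdot> (A2 \<cdot> B2) \<cdot> ?Z"
  proof -
    have 1: "(br a2 t1 \<triangleleft> t2) \<cdot> (B1 \<triangleleft> t2) = (B1 \<triangleleft> a2 \<bullet> t2) \<cdot> (br a2 (b1 \<bullet> c1) \<triangleleft> t2)"
      using arg_cong[OF br_nat_right[OF B1, of a2], of "\<lambda>x. x \<triangleleft> t2"] by (simp add: ract_simps)
    have 2: "(br a2 (b1 \<bullet> c1) \<triangleleft> t2) \<cdot> B2 = B2 \<cdot> (br a2 (b1 \<bullet> c1) \<triangleleft> b2 \<bullet> c2)"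
      by (rule slide[OF B2, symmetric]) simp_all
    have 3: "A2 \<cdot> (B1 \<triangleleft> a2 \<bullet> t2) = (B1 \<triangleleft> u2) \<cdot> A2"
      by (rule slide[OF A2]) simp_all
    show ?thesis
      by (simp add: ract_simps 1[THEN bd.G.mult_extend] 2[THEN bd.G.mult_extend] 3[THEN bd.G.mult_extend])
  qed
  moreover have "?R = ?K \<cdot> (C2 \<cdot> (E2 \<triangleleft> c2)) \<cdot> ?Z"
  proof -
    have 1: "(br s2 c1 \<triangleleft> c2) \<cdot> (E1 \<triangleleft> s2 \<bullet> (c1 \<bullet> c2)) = (E1 \<triangleleft> c1 \<bullet> (s2 \<bullet> c2)) \<cdot> (br s2 c1 \<triangleleft> c2)"
      using arg_cong[OF br_slide[of s2 c1 E1], of "\<lambda>x. x \<triangleleft> c2"] by (simp add: ract_simps)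
    have 2: "C2 \<cdot> (E1 \<triangleleft> c1 \<bullet> (s2 \<bullet> c2)) = (E1 \<triangleleft> c1 \<bullet> u2) \<cdot> C2"
      using slide[OF C2, of "E1 \<triangleleft> c1"] by (simp add: ract_simps)
    have 3: "(br s2 c1 \<triangleleft> c2) \<cdot> (E2 \<triangleleft> c1 \<bullet> c2) = (E2 \<triangleleft> c2) \<cdot> (br (a2 \<bullet> b2) c1 \<triangleleft> c2)"
      using arg_cong[OF br_nat_left[OF E2, of c1], of "\<lambda>x. x \<triangleleft> c2"] by (simp add: ract_simps)
    have 4: "(br b2 c1 \<triangleleft> c2) \<cdot> (br a2 b1 \<triangleleft> b2 \<bullet> (c1 \<bullet> c2)) = (br a2 b1 \<triangleleft> c1 \<bullet> (b2 \<bullet> c2)) \<cdot> (br b2 c1 \<triangleleft> c2)"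
      using arg_cong[OF br_slide[of b2 c1 "br a2 b1"], of "\<lambda>x. x \<triangleleft> c2"] by (simp add: ract_simps)
    have 5: "(br (a2 \<bullet> b2) c1 \<triangleleft> c2) \<cdot> (br a2 b1 \<triangleleft> b2 \<bullet> (c1 \<bullet> c2)) = ?Z"
      by (simp add: ract_simps br_mult_left br_mult_right 4)
    show ?thesis
      by (simp add: ract_simps cocycle1 1[THEN bd.G.mult_extend] 2[THEN bd.G.mult_extend] 3[THEN bd.G.mult_extend] 5)
  qed
  ultimately show ?thesis
    by simp
qed

text \<open>
  Both sides are the product of the three comparison morphisms with the crossings of \<open>a2\<close> with
  \<open>b1\<close>, \<open>a3\<close> with \<open>b1\<close>, and \<open>a3\<close> with \<open>b2\<close>; the first and the last of these commute by
  interchange.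
\<close>
lemma mult_assoc_identity:
  assumes [simp]: "b1 \<in> carrier G0" "a2 \<in> carrier G0" "b2 \<in> carrier G0" "s2 \<in> carrier G0"
      "a3 \<in> carrier G0" "b3 \<in> carrier G0" "s3 \<in> carrier G0"
      "E1 \<in> carrier G1" "E2 \<in> carrier G1" "E3 \<in> carrier G1"
    and E3: "s3 \<bullet> bd E3 = a3 \<bullet> b3"
  shows "(((E1 \<triangleleft> s2) \<cdot> E2 \<cdot> (br a2 b1 \<triangleleft> b2)) \<triangleleft> s3) \<cdot> E3 \<cdot> (br a3 (b1 \<bullet> b2) \<triangleleft> b3)
    = (E1 \<triangleleft> s2 \<bullet> s3) \<cdot> ((E2 \<triangleleft> s3) \<cdot> E3 \<cdot> (br a3 b2 \<triangleleft> b3)) \<cdot> (br (a2 \<bullet> a3) b1 \<triangleleft> b2 \<bullet> b3)"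
proof -
  have 1: "(br a2 b1 \<triangleleft> b2 \<bullet> s3) \<cdot> E3 = E3 \<cdot> (br a2 b1 \<triangleleft> b2 \<bullet> (a3 \<bullet> b3))"
    using slide[OF E3, of "br a2 b1 \<triangleleft> b2"] by (simp add: ract_simps)
  have 2: "(br a3 b2 \<triangleleft> b3) \<cdot> (br a2 b1 \<triangleleft> a3 \<bullet> (b2 \<bullet> b3)) = (br a2 b1 \<triangleleft> b2 \<bullet> (a3 \<bullet> b3)) \<cdot> (br a3 b2 \<triangleleft> b3)"
    using arg_cong[OF br_slide[of a3 b2 "br a2 b1"], of "\<lambda>x. x \<triangleleft> b3"] by (simp add: ract_simps)
  show ?thesis
    by (simp add: ract_simps br_mult_left br_mult_right 1[THEN bd.G.mult_extend] 2[THEN bd.G.mult_extend])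
qed

text \<open>
  Naturality of the isomorphism \<open>\<theta> \<sigma> = br (p1 \<sigma>) (p2 \<sigma>)\<close>. Pulling \<open>E1\<close> and \<open>E2\<close> through \<open>br s1 s2\<close>
  turns it into the crossing of \<open>a1 \<bullet> b1\<close> with \<open>a2 \<bullet> b2\<close>, which the hexagon laws break up into four
  crossings of single letters. The crossing of \<open>b1\<close> with \<open>a2\<close> then meets the \<open>br a2 b1\<close> of the
  product, and a symmetric braiding cancels the two.
\<close>
lemma mult_commute_identity:
  assumes [simp]: "a1 \<in> carrier G0" "b1 \<in> carrier G0" "s1 \<in> carrier G0" "E1 \<in> carrier G1"
      "a2 \<in> carrier G0" "b2 \<in> carrier G0" "s2 \<in> carrier G0" "E2 \<in> carrier G1"
    and E1: "s1 \<bullet> bd E1 = a1 \<bullet> b1" and E2: "s2 \<bullet> bd E2 = a2 \<bullet> b2"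
    and symmetric: "br b1 a2 \<cdot> br a2 b1 = \<one>\<^bsub>G1\<^esub>"
  shows "(E2 \<triangleleft> s1) \<cdot> E1 \<cdot> (br a1 b2 \<triangleleft> b1)
    = br s1 s2 \<cdot> ((E1 \<triangleleft> s2) \<cdot> E2 \<cdot> (br a2 b1 \<triangleleft> b2)) \<cdot> inv1 (br b1 b2) \<cdot> (inv1 (br a1 a2) \<triangleleft> b2 \<bullet> b1)"
proof -
  have 1: "br s1 s2 \<cdot> (E1 \<triangleleft> s2) = E1 \<cdot> br (a1 \<bullet> b1) s2"
    by (rule br_nat_left[OF E1]) simp_all
  have 2: "br (a1 \<bullet> b1) s2 \<cdot> E2 = (E2 \<triangleleft> a1 \<bullet> b1) \<cdot> br (a1 \<bullet> b1) (a2 \<bullet> b2)"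
    by (rule br_nat_right[OF E2]) simp_all
  have 3: "E1 \<cdot> (E2 \<triangleleft> a1 \<bullet> b1) = (E2 \<triangleleft> s1) \<cdot> E1"
    by (rule slide[OF E1]) simp_all
  have 4: "br (a1 \<bullet> b1) (a2 \<bullet> b2) \<cdot> (br a2 b1 \<triangleleft> b2)
      = (br a1 b2 \<triangleleft> b1) \<cdot> (br a1 a2 \<triangleleft> b2 \<bullet> b1) \<cdot> br b1 b2"
  proof -
    have "(br b1 a2 \<triangleleft> b2) \<cdot> (br a2 b1 \<triangleleft> b2) = \<one>\<^bsub>G1\<^esub>"
      by (simp add: symmetric ract_unit flip: ract_distrib)
    then show ?thesis
      by (simp add: ract_simps br_mult_left br_mult_right br_slide)
  qed
  show ?thesis
    by (simp add: ract_simps 1[THEN bd.G.mult_extend] 2[THEN bd.G.mult_extend] 3[THEN bd.G.mult_extend]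
      4[unfolded ract_simps, THEN bd.G.mult_extend])
qed

text \<open>
  Multiplying an isomorphism \<open>(g, \<theta>)\<close> by the cocycle \<open>(p2, \<epsilon>2)\<close> on the right gives
  \<open>(g, \<lambda>\<sigma>. (\<theta> \<sigma> \<triangleleft> p2 \<sigma>) \<cdot> br (p2 \<sigma>) (\<sigma>g))\<close>: the crossing is needed because \<open>\<sigma>g\<close> has to pass from
  the left of \<open>p2 \<sigma>\<close> to its right. Here \<open>c1 = \<sigma>(q1 \<tau>)\<close> belongs to the target of the isomorphism,
  \<open>h = \<sigma>g\<close>, \<open>k = (\<sigma>\<tau>)g\<close>, and \<open>Ta\<close>, \<open>Tb\<close>, \<open>Ts\<close> are \<open>\<theta> \<sigma>\<close>, \<open>\<sigma>(\<theta> \<tau>)\<close>, \<open>\<theta> (\<sigma>\<tau>)\<close>.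

  The steps \<open>L1\<close> to \<open>L3\<close> bring the left side, and \<open>R1\<close> to \<open>R3\<close> the right side, into a form where only
  the naturality of \<open>br a2\<close> along \<open>Tb : h \<bullet> c1 \<rightarrow> b1 \<bullet> k\<close> is left, which is \<open>R4\<close>.
\<close>
lemma mult_iso_left_identity:
  assumes [simp]: "b1 \<in> carrier G0" "c1 \<in> carrier G0" "E1 \<in> carrier G1"
      "a2 \<in> carrier G0" "b2 \<in> carrier G0" "s2 \<in> carrier G0" "E2 \<in> carrier G1"
      "h \<in> carrier G0" "k \<in> carrier G0"
      "Ta \<in> carrier G1" "Tb \<in> carrier G1" "Ts \<in> carrier G1"
    and E2: "s2 \<bullet> bd E2 = a2 \<bullet> b2"
    and c1: "c1 = inv0 h \<bullet> b1 \<bullet> k \<bullet> inv0 (bd Tb)"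
  shows "((Ts \<cdot> (E1 \<triangleleft> k) \<cdot> inv1 Tb \<cdot> (inv1 Ta \<triangleleft> c1)) \<triangleleft> s2) \<cdot> E2 \<cdot> (br a2 c1 \<triangleleft> b2)
    = ((Ts \<triangleleft> s2) \<cdot> br s2 k) \<cdot> (((E1 \<triangleleft> s2) \<cdot> E2 \<cdot> (br a2 b1 \<triangleleft> b2)) \<triangleleft> k)
      \<cdot> inv1 ((Tb \<triangleleft> b2) \<cdot> br b2 k) \<cdot> (inv1 ((Ta \<triangleleft> a2) \<cdot> br a2 h) \<triangleleft> c1 \<bullet> b2)"
proof -
  have c1': "h \<bullet> c1 \<bullet> bd Tb = b1 \<bullet> k"
    by (simp add: c1 ract_simps)
  have L1: "inv1 (Tb \<triangleleft> s2) \<cdot> E2 = E2 \<cdot> inv1 (Tb \<triangleleft> a2 \<bullet> b2)"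
    using slide[OF E2, of "inv1 Tb"] by (simp add: ract_simps)
  have L2: "inv1 (Ta \<triangleleft> c1 \<bullet> s2) \<cdot> E2 = E2 \<cdot> inv1 (Ta \<triangleleft> c1 \<bullet> (a2 \<bullet> b2))"
    using slide[OF E2, of "inv1 Ta \<triangleleft> c1"] by (simp add: ract_simps)
  have L3: "inv1 (Ta \<triangleleft> c1 \<bullet> (a2 \<bullet> b2)) \<cdot> (br a2 c1 \<triangleleft> b2) = (br a2 c1 \<triangleleft> b2) \<cdot> inv1 (Ta \<triangleleft> a2 \<bullet> (c1 \<bullet> b2))"
    using arg_cong[OF br_slide[of a2 c1 "inv1 Ta"], of "\<lambda>x. x \<triangleleft> b2"] by (simp add: ract_simps)
  have R1: "br s2 k \<cdot> (E1 \<triangleleft> s2 \<bullet> k) = (E1 \<triangleleft> k \<bullet> s2) \<cdot> br s2 k"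
    by (rule br_slide) simp_all
  have R2: "br s2 k \<cdot> (E2 \<triangleleft> k) = E2 \<cdot> (br a2 k \<triangleleft> b2) \<cdot> br b2 k"
    using br_nat_left[OF E2, of k] by (simp add: br_mult_left ract_simps)
  have R3: "br b2 k \<cdot> (br a2 b1 \<triangleleft> b2 \<bullet> k) = (br a2 b1 \<triangleleft> k \<bullet> b2) \<cdot> br b2 k"
    by (rule br_slide) simp_all
  have R4: "(br a2 k \<triangleleft> b2) \<cdot> (br a2 b1 \<triangleleft> k \<bullet> b2) \<cdot> inv1 (Tb \<triangleleft> b2)
      = inv1 (Tb \<triangleleft> a2 \<bullet> b2) \<cdot> (br a2 c1 \<triangleleft> b2) \<cdot> (br a2 h \<triangleleft> c1 \<bullet> b2)"
  proof -
    have "br a2 (h \<bullet> c1) \<cdot> Tb = (Tb \<triangleleft> a2) \<cdot> br a2 (b1 \<bullet> k)"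
      using c1' by (rule br_nat_right) simp_all
    then have "inv1 (Tb \<triangleleft> a2) \<cdot> (br a2 (h \<bullet> c1) \<cdot> Tb) = br a2 (b1 \<bullet> k)"
      by (simp add: ract_simps)
    from arg_cong[OF this, of "\<lambda>x. x \<cdot> inv1 Tb"]
    have "br a2 k \<cdot> (br a2 b1 \<triangleleft> k) \<cdot> inv1 Tb = inv1 (Tb \<triangleleft> a2) \<cdot> br a2 c1 \<cdot> (br a2 h \<triangleleft> c1)"
      by (simp add: br_mult_right ract_simps)
    from arg_cong[OF this, of "\<lambda>x. x \<triangleleft> b2"] show ?thesis
      by (simp add: ract_simps)
  qed
  have "(br s2 k) \<cdot> (((E1 \<triangleleft> s2) \<cdot> E2 \<cdot> (br a2 b1 \<triangleleft> b2)) \<triangleleft> k) \<cdot> inv1 ((Tb \<triangleleft> b2) \<cdot> br b2 k)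
    = (E1 \<triangleleft> k \<bullet> s2) \<cdot> E2 \<cdot> ((br a2 k \<triangleleft> b2) \<cdot> (br a2 b1 \<triangleleft> k \<bullet> b2) \<cdot> inv1 (Tb \<triangleleft> b2))"
    by (simp add: ract_simps R1[THEN bd.G.mult_extend] R2[THEN bd.G.mult_extend] R3[THEN bd.G.mult_extend])
  then have "((Ts \<triangleleft> s2) \<cdot> br s2 k) \<cdot> (((E1 \<triangleleft> s2) \<cdot> E2 \<cdot> (br a2 b1 \<triangleleft> b2)) \<triangleleft> k) \<cdot> inv1 ((Tb \<triangleleft> b2) \<cdot> br b2 k)
    = (Ts \<triangleleft> s2) \<cdot> (E1 \<triangleleft> k \<bullet> s2) \<cdot> E2 \<cdot> (inv1 (Tb \<triangleleft> a2 \<bullet> b2) \<cdot> (br a2 c1 \<triangleleft> b2) \<cdot> (br a2 h \<triangleleft> c1 \<bullet> b2))"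
    unfolding R4 by (simp add: bd.G.m_assoc)
  then show ?thesis
    by (simp add: ract_simps L1[THEN bd.G.mult_extend] L2[THEN bd.G.mult_extend] L3)
qed

section \<open>The product of cocycles\<close>

lemma br_one_left: "g \<in> carrier G0 \<Longrightarrow> br \<one>\<^bsub>G0\<^esub> g = \<one>\<^bsub>G1\<^esub>"
  using br_bd_left[of "\<one>\<^bsub>G1\<^esub>" g] by (simp add: ract_unit)

lemma br_one_right: "g \<in> carrier G0 \<Longrightarrow> br g \<one>\<^bsub>G0\<^esub> = \<one>\<^bsub>G1\<^esub>"
  using br_bd_right[of "\<one>\<^bsub>G1\<^esub>" g] by (simp add: ract_unit)

text \<open>
  One direction says that the product of cocycles is a cocycle. The other one yields
  inverses: a pair of maps \<open>(p2, \<epsilon>2)\<close> is a cocycle as soon as its product with some cocycle is.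
\<close>
lemma cocycle_mult_mem_iff:
  assumes 1: "(p1, \<epsilon>1) \<in> Z1"
    and p2: "p2 \<in> carrier \<Gamma> \<rightarrow>\<^sub>E carrier G0" "p2 \<one>\<^bsub>\<Gamma>\<^esub> = \<one>\<^bsub>G0\<^esub>"
    and \<epsilon>2: "\<epsilon>2 \<in> carrier \<Gamma> \<times> carrier \<Gamma> \<rightarrow>\<^sub>E carrier G1" "\<epsilon>2 (\<one>\<^bsub>\<Gamma>\<^esub>, \<one>\<^bsub>\<Gamma>\<^esub>) = \<one>\<^bsub>G1\<^esub>"
  shows "cocycle_mult (p1, \<epsilon>1) (p2, \<epsilon>2) \<in> Z1 \<longleftrightarrow> (p2, \<epsilon>2) \<in> Z1"
proof -
  define p where "p = (\<lambda>\<sigma>. p1 \<sigma> \<bullet> p2 \<sigma>)"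
  define \<epsilon> where "\<epsilon> = (\<lambda>\<sigma> \<tau>. (\<epsilon>1 (\<sigma>, \<tau>) \<triangleleft> p2 (\<sigma> \<otimes>\<^bsub>\<Gamma>\<^esub> \<tau>)) \<cdot> \<epsilon>2 (\<sigma>, \<tau>)
      \<cdot> (br (p2 \<sigma>) (act0 \<sigma> (p1 \<tau>)) \<triangleleft> act0 \<sigma> (p2 \<tau>)))"
  note [simp] = Z1_closed[OF 1]
  have [simp]: "p2 \<sigma> \<in> carrier G0" if "\<sigma> \<in> carrier \<Gamma>" for \<sigma>
    using p2 that by auto
  have [simp]: "\<epsilon>2 (\<sigma>, \<tau>) \<in> carrier G1" if "\<sigma> \<in> carrier \<Gamma>" "\<tau> \<in> carrier \<Gamma>" for \<sigma> \<tau>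
    using \<epsilon>2 that by (auto simp: PiE_mem)
  have [simp]: "p1 \<one>\<^bsub>\<Gamma>\<^esub> = \<one>\<^bsub>G0\<^esub>" "\<epsilon>1 (\<one>\<^bsub>\<Gamma>\<^esub>, \<one>\<^bsub>\<Gamma>\<^esub>) = \<one>\<^bsub>G1\<^esub>"
    using 1 by (simp_all add: Z1_iff)
  note p2(2) [simp] \<epsilon>2(2) [simp]
  have mem: "cocycle_mult (p1, \<epsilon>1) (p2, \<epsilon>2) \<in> Z1 \<longleftrightarrow>
     (\<forall>\<sigma>\<in>carrier \<Gamma>. \<forall>\<tau>\<in>carrier \<Gamma>. p (\<sigma> \<otimes>\<^bsub>\<Gamma>\<^esub> \<tau>) \<bullet> bd (\<epsilon> \<sigma> \<tau>) = p \<sigma> \<bullet> act0 \<sigma> (p \<tau>)) \<and>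
     (\<forall>\<sigma>\<in>carrier \<Gamma>. \<forall>\<tau>\<in>carrier \<Gamma>. \<forall>\<upsilon>\<in>carrier \<Gamma>.
        \<epsilon> \<sigma> (\<tau> \<otimes>\<^bsub>\<Gamma>\<^esub> \<upsilon>) \<cdot> act1 \<sigma> (\<epsilon> \<tau> \<upsilon>) =
        \<epsilon> (\<sigma> \<otimes>\<^bsub>\<Gamma>\<^esub> \<tau>) \<upsilon> \<cdot> (\<epsilon> \<sigma> \<tau> \<triangleleft> act0 (\<sigma> \<otimes>\<^bsub>\<Gamma>\<^esub> \<tau>) (p \<upsilon>)))"
  proof -
    have prod: "cocycle_mult (p1, \<epsilon>1) (p2, \<epsilon>2)
        = (\<lambda>\<sigma>\<in>carrier \<Gamma>. p \<sigma>, \<lambda>(\<sigma>, \<tau>)\<in>carrier \<Gamma> \<times> carrier \<Gamma>. \<epsilon> \<sigma> \<tau>)"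
      by (simp add: p_def \<epsilon>_def)
    have [simp]: "p \<sigma> \<in> carrier G0" if "\<sigma> \<in> carrier \<Gamma>" for \<sigma>
      using that by (simp add: p_def)
    have [simp]: "\<epsilon> \<sigma> \<tau> \<in> carrier G1" if "\<sigma> \<in> carrier \<Gamma>" "\<tau> \<in> carrier \<Gamma>" for \<sigma> \<tau>
      using that by (simp add: \<epsilon>_def)
    have pointed [simp]: "p \<one>\<^bsub>\<Gamma>\<^esub> = \<one>\<^bsub>G0\<^esub>" "\<epsilon> \<one>\<^bsub>\<Gamma>\<^esub> \<one>\<^bsub>\<Gamma>\<^esub> = \<one>\<^bsub>G1\<^esub>"
      by (simp_all add: p_def \<epsilon>_def ract.ract_one act0.act_one br_one_left)
    have "(\<lambda>(\<sigma>, \<tau>)\<in>carrier \<Gamma> \<times> carrier \<Gamma>. \<epsilon> \<sigma> \<tau>) \<in> carrier \<Gamma> \<times> carrier \<Gamma> \<rightarrow>\<^sub>E carrier G1"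
      by auto
    then show ?thesis
      unfolding prod Z1_iff by simp
  qed
  have boundary: "p (\<sigma> \<otimes>\<^bsub>\<Gamma>\<^esub> \<tau>) \<bullet> bd (\<epsilon> \<sigma> \<tau>) = p \<sigma> \<bullet> act0 \<sigma> (p \<tau>)
      \<longleftrightarrow> p2 (\<sigma> \<otimes>\<^bsub>\<Gamma>\<^esub> \<tau>) \<bullet> bd (\<epsilon>2 (\<sigma>, \<tau>)) = p2 \<sigma> \<bullet> act0 \<sigma> (p2 \<tau>)"
    if [simp]: "\<sigma> \<in> carrier \<Gamma>" "\<tau> \<in> carrier \<Gamma>" for \<sigma> \<tau>
    unfolding p_def \<epsilon>_def by (simp del: bd.hom_mult add: act0.act_distrib mult_boundary_iff Z1_boundary[OF 1])
  have cocycle: "\<epsilon> \<sigma> (\<tau> \<otimes>\<^bsub>\<Gamma>\<^esub> \<upsilon>) \<cdot> act1 \<sigma> (\<epsilon> \<tau> \<upsilon>) =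
        \<epsilon> (\<sigma> \<otimes>\<^bsub>\<Gamma>\<^esub> \<tau>) \<upsilon> \<cdot> (\<epsilon> \<sigma> \<tau> \<triangleleft> act0 (\<sigma> \<otimes>\<^bsub>\<Gamma>\<^esub> \<tau>) (p \<upsilon>))
      \<longleftrightarrow> \<epsilon>2 (\<sigma>, \<tau> \<otimes>\<^bsub>\<Gamma>\<^esub> \<upsilon>) \<cdot> act1 \<sigma> (\<epsilon>2 (\<tau>, \<upsilon>)) =
        \<epsilon>2 (\<sigma> \<otimes>\<^bsub>\<Gamma>\<^esub> \<tau>, \<upsilon>) \<cdot> (\<epsilon>2 (\<sigma>, \<tau>) \<triangleleft> act0 (\<sigma> \<otimes>\<^bsub>\<Gamma>\<^esub> \<tau>) (p2 \<upsilon>))"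
    if bd2: "\<And>\<sigma> \<tau>. \<lbrakk>\<sigma> \<in> carrier \<Gamma>; \<tau> \<in> carrier \<Gamma>\<rbrakk>
          \<Longrightarrow> p2 (\<sigma> \<otimes>\<^bsub>\<Gamma>\<^esub> \<tau>) \<bullet> bd (\<epsilon>2 (\<sigma>, \<tau>)) = p2 \<sigma> \<bullet> act0 \<sigma> (p2 \<tau>)"
      and [simp]: "\<sigma> \<in> carrier \<Gamma>" "\<tau> \<in> carrier \<Gamma>" "\<upsilon> \<in> carrier \<Gamma>" for \<sigma> \<tau> \<upsilon>
  proof -
    have shift: "act0 \<sigma> (q (\<tau> \<otimes>\<^bsub>\<Gamma>\<^esub> \<upsilon>)) \<bullet> bd (act1 \<sigma> (\<delta> (\<tau>, \<upsilon>)))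
        = act0 \<sigma> (q \<tau>) \<bullet> act0 (\<sigma> \<otimes>\<^bsub>\<Gamma>\<^esub> \<tau>) (q \<upsilon>)"
      if "q (\<tau> \<otimes>\<^bsub>\<Gamma>\<^esub> \<upsilon>) \<bullet> bd (\<delta> (\<tau>, \<upsilon>)) = q \<tau> \<bullet> act0 \<tau> (q \<upsilon>)"
        "q (\<tau> \<otimes>\<^bsub>\<Gamma>\<^esub> \<upsilon>) \<in> carrier G0" "q \<tau> \<in> carrier G0" "q \<upsilon> \<in> carrier G0" "\<delta> (\<tau>, \<upsilon>) \<in> carrier G1" for q \<delta>
      using arg_cong[OF that(1), of "act0 \<sigma>"] that(2-)
      by (simp add: act0.act_distrib act0.act_mult bd_act)
    have \<epsilon>_act: "act1 \<sigma> (\<epsilon> \<tau> \<upsilon>) = (act1 \<sigma> (\<epsilon>1 (\<tau>, \<upsilon>)) \<triangleleft> act0 \<sigma> (p2 (\<tau> \<otimes>\<^bsub>\<Gamma>\<^esub> \<upsilon>))) \<cdot> act1 \<sigma> (\<epsilon>2 (\<tau>, \<upsilon>))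
        \<cdot> (br (act0 \<sigma> (p2 \<tau>)) (act0 (\<sigma> \<otimes>\<^bsub>\<Gamma>\<^esub> \<tau>) (p1 \<upsilon>)) \<triangleleft> act0 (\<sigma> \<otimes>\<^bsub>\<Gamma>\<^esub> \<tau>) (p2 \<upsilon>))"
      by (simp add: \<epsilon>_def act1.act_distrib act_ract br_act[symmetric] act0.act_mult)
    have bd2': "p2 (\<sigma> \<otimes>\<^bsub>\<Gamma>\<^esub> (\<tau> \<otimes>\<^bsub>\<Gamma>\<^esub> \<upsilon>)) \<bullet> bd (\<epsilon>2 (\<sigma> \<otimes>\<^bsub>\<Gamma>\<^esub> \<tau>, \<upsilon>))
        = p2 (\<sigma> \<otimes>\<^bsub>\<Gamma>\<^esub> \<tau>) \<bullet> act0 (\<sigma> \<otimes>\<^bsub>\<Gamma>\<^esub> \<tau>) (p2 \<upsilon>)"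
      using bd2[of "\<sigma> \<otimes>\<^bsub>\<Gamma>\<^esub> \<tau>" \<upsilon>] by (simp add: act0.\<Gamma>.m_assoc)
    have cocycle1: "\<epsilon>1 (\<sigma>, \<tau> \<otimes>\<^bsub>\<Gamma>\<^esub> \<upsilon>) \<cdot> act1 \<sigma> (\<epsilon>1 (\<tau>, \<upsilon>)) =
        \<epsilon>1 (\<sigma> \<otimes>\<^bsub>\<Gamma>\<^esub> \<tau>, \<upsilon>) \<cdot> (\<epsilon>1 (\<sigma>, \<tau>) \<triangleleft> act0 (\<sigma> \<otimes>\<^bsub>\<Gamma>\<^esub> \<tau>) (p1 \<upsilon>))"
      using 1 that unfolding Z1_iff by blast
    have \<epsilon>_assoc: "\<epsilon> (\<sigma> \<otimes>\<^bsub>\<Gamma>\<^esub> \<tau>) \<upsilon>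
        = (\<epsilon>1 (\<sigma> \<otimes>\<^bsub>\<Gamma>\<^esub> \<tau>, \<upsilon>) \<triangleleft> p2 (\<sigma> \<otimes>\<^bsub>\<Gamma>\<^esub> (\<tau> \<otimes>\<^bsub>\<Gamma>\<^esub> \<upsilon>))) \<cdot> \<epsilon>2 (\<sigma> \<otimes>\<^bsub>\<Gamma>\<^esub> \<tau>, \<upsilon>)
          \<cdot> (br (p2 (\<sigma> \<otimes>\<^bsub>\<Gamma>\<^esub> \<tau>)) (act0 (\<sigma> \<otimes>\<^bsub>\<Gamma>\<^esub> \<tau>) (p1 \<upsilon>)) \<triangleleft> act0 (\<sigma> \<otimes>\<^bsub>\<Gamma>\<^esub> \<tau>) (p2 \<upsilon>))"
      by (simp add: \<epsilon>_def act0.\<Gamma>.m_assoc)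
    have p_act: "act0 (\<sigma> \<otimes>\<^bsub>\<Gamma>\<^esub> \<tau>) (p \<upsilon>) = act0 (\<sigma> \<otimes>\<^bsub>\<Gamma>\<^esub> \<tau>) (p1 \<upsilon>) \<bullet> act0 (\<sigma> \<otimes>\<^bsub>\<Gamma>\<^esub> \<tau>) (p2 \<upsilon>)"
      by (simp add: p_def act0.act_distrib)
    show ?thesis
      unfolding \<epsilon>_act \<epsilon>_assoc p_act unfolding \<epsilon>_def
      by (rule mult_cocycle_iff)
        (simp_all add: shift[of p1 \<epsilon>1] shift[of p2 \<epsilon>2] Z1_boundary[OF 1] bd2 bd2' cocycle1)
  qed
  show ?thesis
  proof (cases "\<forall>\<sigma>\<in>carrier \<Gamma>. \<forall>\<tau>\<in>carrier \<Gamma>.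
      p2 (\<sigma> \<otimes>\<^bsub>\<Gamma>\<^esub> \<tau>) \<bullet> bd (\<epsilon>2 (\<sigma>, \<tau>)) = p2 \<sigma> \<bullet> act0 \<sigma> (p2 \<tau>)")
    case True
    then show ?thesis
      unfolding mem Z1_iff[of p2] using p2 \<epsilon>2 by (simp only: boundary cocycle simp_thms ball_simps cong: ball_cong)
  next
    case False
    then show ?thesis
      unfolding mem Z1_iff[of p2] using boundary by blast
  qed
qed

lemma cocycle_mult_closed: "\<lbrakk>x \<in> Z1; y \<in> Z1\<rbrakk> \<Longrightarrow> cocycle_mult x y \<in> Z1"
  by (cases x; cases y) (simp del: cocycle_mult.simps add: cocycle_mult_mem_iff Z1_iff)

lemma cocycle_one_mem: "cocycle_one \<in> Z1"
  by (simp add: cocycle_one_def Z1_iff case_prod_unfold mem_Times_iff act0.act_unit act1.act_unit ract_unit)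

lemma cocycle_mult_one_left: "x \<in> Z1 \<Longrightarrow> cocycle_mult cocycle_one x = x"
proof -
  assume "x \<in> Z1"
  obtain p \<epsilon> where x: "x = (p, \<epsilon>)" by force
  with \<open>x \<in> Z1\<close> have 1: "(p, \<epsilon>) \<in> Z1" by simp
  note [simp] = Z1_closed[OF 1]
  have "p \<in> extensional (carrier \<Gamma>)" "\<epsilon> \<in> extensional (carrier \<Gamma> \<times> carrier \<Gamma>)"
    using 1 by (simp_all add: Z1_iff PiE_iff)
  then show ?thesis
    unfolding x cocycle_one_def cocycle_mult.simps
    by (intro cochain_eqI) (simp_all add: ract_unit act0.act_unit br_one_right)
qed

lemma cocycle_mult_assoc:
  assumes "x \<in> Z1" "y \<in> Z1" "z \<in> Z1"
  shows "cocycle_mult (cocycle_mult x y) z = cocycle_mult x (cocycle_mult y z)"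
proof -
  obtain p1 \<epsilon>1 p2 \<epsilon>2 p3 \<epsilon>3
    where x: "x = (p1, \<epsilon>1)" and y: "y = (p2, \<epsilon>2)" and z: "z = (p3, \<epsilon>3)" by force
  note [simp] = Z1_closed[OF assms(1)[unfolded x]] Z1_closed[OF assms(2)[unfolded y]]
    Z1_closed[OF assms(3)[unfolded z]]
  show ?thesis
    unfolding x y z cocycle_mult.simps
    by (intro cochain_eqI)
      (simp_all add: bd.H.m_assoc act0.act_distrib mult_assoc_identity Z1_boundary[OF assms(3)[unfolded z]])
qed

text \<open>
  The defining formulas of the product can be solved for the second factor such that the product is
  \<open>cocycle_one\<close>; by \<open>cocycle_mult_mem_iff\<close> the solution satisfies the cocycle identities.
\<close>
lemma cocycle_right_inverse:
  assumes "x \<in> Z1"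
  shows "\<exists>y\<in>Z1. cocycle_mult x y = cocycle_one"
proof -
  obtain p1 \<epsilon>1 where x: "x = (p1, \<epsilon>1)" by force
  with assms have 1: "(p1, \<epsilon>1) \<in> Z1" by simp
  note [simp] = Z1_closed[OF 1]
  have [simp]: "p1 \<one>\<^bsub>\<Gamma>\<^esub> = \<one>\<^bsub>G0\<^esub>" "\<epsilon>1 (\<one>\<^bsub>\<Gamma>\<^esub>, \<one>\<^bsub>\<Gamma>\<^esub>) = \<one>\<^bsub>G1\<^esub>"
    using 1 by (simp_all add: Z1_iff)
  define p2 where "p2 = (\<lambda>\<sigma>\<in>carrier \<Gamma>. inv0 (p1 \<sigma>))"
  define \<epsilon>2 where "\<epsilon>2 = (\<lambda>(\<sigma>, \<tau>)\<in>carrier \<Gamma> \<times> carrier \<Gamma>.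
    inv1 (\<epsilon>1 (\<sigma>, \<tau>) \<triangleleft> p2 (\<sigma> \<otimes>\<^bsub>\<Gamma>\<^esub> \<tau>)) \<cdot> inv1 (br (p2 \<sigma>) (act0 \<sigma> (p1 \<tau>)) \<triangleleft> act0 \<sigma> (p2 \<tau>)))"
  have p2_closed [simp]: "p2 \<sigma> \<in> carrier G0" if "\<sigma> \<in> carrier \<Gamma>" for \<sigma>
    using that by (simp add: p2_def)
  have p2: "p2 \<in> carrier \<Gamma> \<rightarrow>\<^sub>E carrier G0" "p2 \<one>\<^bsub>\<Gamma>\<^esub> = \<one>\<^bsub>G0\<^esub>"
    by (simp_all add: p2_def)
  have \<epsilon>2: "\<epsilon>2 \<in> carrier \<Gamma> \<times> carrier \<Gamma> \<rightarrow>\<^sub>E carrier G1" "\<epsilon>2 (\<one>\<^bsub>\<Gamma>\<^esub>, \<one>\<^bsub>\<Gamma>\<^esub>) = \<one>\<^bsub>G1\<^esub>"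
  proof -
    show "\<epsilon>2 \<in> carrier \<Gamma> \<times> carrier \<Gamma> \<rightarrow>\<^sub>E carrier G1"
      unfolding \<epsilon>2_def by (auto simp del: bd.G.inv_mult_group)
    show "\<epsilon>2 (\<one>\<^bsub>\<Gamma>\<^esub>, \<one>\<^bsub>\<Gamma>\<^esub>) = \<one>\<^bsub>G1\<^esub>"
      by (simp add: \<epsilon>2_def p2(2) ract_unit act0.act_one br_one_left)
  qed
  have prod: "cocycle_mult (p1, \<epsilon>1) (p2, \<epsilon>2) = cocycle_one"
    unfolding cocycle_one_def cocycle_mult.simps
    by (intro cochain_eqI) (simp_all add: p2_def \<epsilon>2_def bd.G.m_assoc bd.G.cancel_inv_left)
  with cocycle_mult_mem_iff[OF 1 p2 \<epsilon>2] cocycle_one_mem have "(p2, \<epsilon>2) \<in> Z1"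
    by simp
  with prod show ?thesis
    unfolding x by blast
qed

lemma cocycle_mult_iso_left:
  assumes "(x, x') \<in> cocycle_iso" "y \<in> Z1"
  shows "(cocycle_mult x y, cocycle_mult x' y) \<in> cocycle_iso"
proof -
  obtain p1 \<epsilon>1 q1 \<delta>1 p2 \<epsilon>2
    where x: "x = (p1, \<epsilon>1)" and x': "x' = (q1, \<delta>1)" and y: "y = (p2, \<epsilon>2)" by force
  from assms(1) obtain g \<theta> where 1: "(p1, \<epsilon>1) \<in> Z1" and 3: "(q1, \<delta>1) \<in> Z1"
    and [simp]: "g \<in> carrier G0" "\<And>\<sigma>. \<sigma> \<in> carrier \<Gamma> \<Longrightarrow> \<theta> \<sigma> \<in> carrier G1" "\<theta> \<one>\<^bsub>\<Gamma>\<^esub> = \<one>\<^bsub>G1\<^esub>"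
    and q1: "\<And>\<sigma>. \<sigma> \<in> carrier \<Gamma> \<Longrightarrow> q1 \<sigma> = inv0 g \<bullet> p1 \<sigma> \<bullet> act0 \<sigma> g \<bullet> inv0 (bd (\<theta> \<sigma>))"
    and \<delta>1: "\<And>\<sigma> \<tau>. \<lbrakk>\<sigma> \<in> carrier \<Gamma>; \<tau> \<in> carrier \<Gamma>\<rbrakk> \<Longrightarrow> \<delta>1 (\<sigma>, \<tau>) =
      \<theta> (\<sigma> \<otimes>\<^bsub>\<Gamma>\<^esub> \<tau>) \<cdot> (\<epsilon>1 (\<sigma>, \<tau>) \<triangleleft> act0 (\<sigma> \<otimes>\<^bsub>\<Gamma>\<^esub> \<tau>) g) \<cdot> inv1 (act1 \<sigma> (\<theta> \<tau>))
        \<cdot> (inv1 (\<theta> \<sigma>) \<triangleleft> act0 \<sigma> (q1 \<tau>))"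
    unfolding x x' by (rule cocycle_isoE) blast
  from assms(2) have 2: "(p2, \<epsilon>2) \<in> Z1" by (simp add: y)
  then have [simp]: "p2 \<one>\<^bsub>\<Gamma>\<^esub> = \<one>\<^bsub>G0\<^esub>" by (simp add: Z1_iff)
  note [simp] = Z1_closed[OF 1] Z1_closed[OF 3] Z1_closed[OF 2]
  note mem = cocycle_mult_closed[OF 1 2] cocycle_mult_closed[OF 3 2]
  let ?\<Theta> = "\<lambda>\<sigma>. (\<theta> \<sigma> \<triangleleft> p2 \<sigma>) \<cdot> br (p2 \<sigma>) (act0 \<sigma> g)"
  show ?thesis
    unfolding x x' y cocycle_mult.simps
  proof (rule cocycle_isoI[of _ _ _ _ g ?\<Theta>, OF mem[unfolded cocycle_mult.simps]])
    fix \<sigma> \<tau> assume [simp]: "\<sigma> \<in> carrier \<Gamma>" "\<tau> \<in> carrier \<Gamma>"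
    have "act0 \<sigma> (q1 \<tau>) = inv0 (act0 \<sigma> g) \<bullet> act0 \<sigma> (p1 \<tau>) \<bullet> act0 (\<sigma> \<otimes>\<^bsub>\<Gamma>\<^esub> \<tau>) g \<bullet> inv0 (bd (act1 \<sigma> (\<theta> \<tau>)))"
      by (simp add: q1 act0.act_distrib act0.act_inv act0.act_mult bd_act)
    note identity = mult_iso_left_identity[OF _ _ _ _ _ _ _ _ _ _ _ _ Z1_boundary[OF 2 \<open>\<sigma> \<in> carrier \<Gamma>\<close> \<open>\<tau> \<in> carrier \<Gamma>\<close>] this]
    have \<Theta>_act: "act1 \<sigma> (?\<Theta> \<tau>) = (act1 \<sigma> (\<theta> \<tau>) \<triangleleft> act0 \<sigma> (p2 \<tau>)) \<cdot> br (act0 \<sigma> (p2 \<tau>)) (act0 (\<sigma> \<otimes>\<^bsub>\<Gamma>\<^esub> \<tau>) g)"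
      by (simp add: act1.act_distrib act_ract br_act[symmetric] act0.act_mult)
    show "(\<lambda>(\<sigma>, \<tau>)\<in>carrier \<Gamma> \<times> carrier \<Gamma>. (\<delta>1 (\<sigma>, \<tau>) \<triangleleft> p2 (\<sigma> \<otimes>\<^bsub>\<Gamma>\<^esub> \<tau>)) \<cdot> \<epsilon>2 (\<sigma>, \<tau>)
          \<cdot> (br (p2 \<sigma>) (act0 \<sigma> (q1 \<tau>)) \<triangleleft> act0 \<sigma> (p2 \<tau>))) (\<sigma>, \<tau>)
      = ?\<Theta> (\<sigma> \<otimes>\<^bsub>\<Gamma>\<^esub> \<tau>) \<cdot> ((\<lambda>(\<sigma>, \<tau>)\<in>carrier \<Gamma> \<times> carrier \<Gamma>. (\<epsilon>1 (\<sigma>, \<tau>) \<triangleleft> p2 (\<sigma> \<otimes>\<^bsub>\<Gamma>\<^esub> \<tau>)) \<cdot> \<epsilon>2 (\<sigma>, \<tau>)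
          \<cdot> (br (p2 \<sigma>) (act0 \<sigma> (p1 \<tau>)) \<triangleleft> act0 \<sigma> (p2 \<tau>))) (\<sigma>, \<tau>) \<triangleleft> act0 (\<sigma> \<otimes>\<^bsub>\<Gamma>\<^esub> \<tau>) g)
        \<cdot> inv1 (act1 \<sigma> (?\<Theta> \<tau>)) \<cdot> (inv1 (?\<Theta> \<sigma>) \<triangleleft> act0 \<sigma> ((\<lambda>\<sigma>\<in>carrier \<Gamma>. q1 \<sigma> \<bullet> p2 \<sigma>) \<tau>))"
      unfolding \<Theta>_act by (simp add: \<delta>1 act0.act_distrib identity del: bd.G.inv_mult_group)
  qed (simp_all add: q1 bd_ract bd_br ract_simps br_one_left act0.act_one)
qed

lemma cocycle_mult_commute:
  assumes "x \<in> Z1" "y \<in> Z1"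
    and symmetric: "\<And>g h. \<lbrakk>g \<in> carrier G0; h \<in> carrier G0\<rbrakk> \<Longrightarrow> br g h \<cdot> br h g = \<one>\<^bsub>G1\<^esub>"
  shows "(cocycle_mult x y, cocycle_mult y x) \<in> cocycle_iso"
proof -
  obtain p1 \<epsilon>1 p2 \<epsilon>2 where x: "x = (p1, \<epsilon>1)" and y: "y = (p2, \<epsilon>2)" by force
  from assms(1,2) have 1: "(p1, \<epsilon>1) \<in> Z1" and 2: "(p2, \<epsilon>2) \<in> Z1" by (simp_all add: x y)
  then have [simp]: "p1 \<one>\<^bsub>\<Gamma>\<^esub> = \<one>\<^bsub>G0\<^esub>" "p2 \<one>\<^bsub>\<Gamma>\<^esub> = \<one>\<^bsub>G0\<^esub>" by (simp_all add: Z1_iff)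
  note [simp] = Z1_closed[OF 1] Z1_closed[OF 2]
  note mem = cocycle_mult_closed[OF 1 2] cocycle_mult_closed[OF 2 1]
  show ?thesis
    unfolding x y cocycle_mult.simps
  proof (rule cocycle_isoI[of _ _ _ _ "\<one>\<^bsub>G0\<^esub>" "\<lambda>\<sigma>. br (p1 \<sigma>) (p2 \<sigma>)", OF mem[unfolded cocycle_mult.simps]])
    fix \<sigma> \<tau> assume [simp]: "\<sigma> \<in> carrier \<Gamma>" "\<tau> \<in> carrier \<Gamma>"
    show "(\<lambda>(\<sigma>, \<tau>)\<in>carrier \<Gamma> \<times> carrier \<Gamma>. (\<epsilon>2 (\<sigma>, \<tau>) \<triangleleft> p1 (\<sigma> \<otimes>\<^bsub>\<Gamma>\<^esub> \<tau>)) \<cdot> \<epsilon>1 (\<sigma>, \<tau>)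
          \<cdot> (br (p1 \<sigma>) (act0 \<sigma> (p2 \<tau>)) \<triangleleft> act0 \<sigma> (p1 \<tau>))) (\<sigma>, \<tau>)
      = br (p1 (\<sigma> \<otimes>\<^bsub>\<Gamma>\<^esub> \<tau>)) (p2 (\<sigma> \<otimes>\<^bsub>\<Gamma>\<^esub> \<tau>))
        \<cdot> ((\<lambda>(\<sigma>, \<tau>)\<in>carrier \<Gamma> \<times> carrier \<Gamma>. (\<epsilon>1 (\<sigma>, \<tau>) \<triangleleft> p2 (\<sigma> \<otimes>\<^bsub>\<Gamma>\<^esub> \<tau>)) \<cdot> \<epsilon>2 (\<sigma>, \<tau>)
          \<cdot> (br (p2 \<sigma>) (act0 \<sigma> (p1 \<tau>)) \<triangleleft> act0 \<sigma> (p2 \<tau>))) (\<sigma>, \<tau>) \<triangleleft> act0 (\<sigma> \<otimes>\<^bsub>\<Gamma>\<^esub> \<tau>) \<one>\<^bsub>G0\<^esub>)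
        \<cdot> inv1 (act1 \<sigma> (br (p1 \<tau>) (p2 \<tau>)))
        \<cdot> (inv1 (br (p1 \<sigma>) (p2 \<sigma>)) \<triangleleft> act0 \<sigma> ((\<lambda>\<sigma>\<in>carrier \<Gamma>. p2 \<sigma> \<bullet> p1 \<sigma>) \<tau>))"
      using mult_commute_identity[OF _ _ _ _ _ _ _ _ Z1_boundary[OF 1, of \<sigma> \<tau>] Z1_boundary[OF 2, of \<sigma> \<tau>] symmetric]
      by (simp add: act0.act_unit ract.ract_one act0.act_distrib br_act[symmetric])
  qed (simp_all add: bd_br act0.act_unit br_one_left ract_simps)
qed

end

section \<open>Commutativity of the group of classes\<close>

theorem corollary4p5:
  fixes \<Gamma> :: "('c, 'k) monoid_scheme"
    and G1 :: "('b, 'n) monoid_scheme" and G0 :: "('a, 'm) monoid_scheme"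
    and bd :: "'b \<Rightarrow> 'a" and ract :: "'b \<Rightarrow> 'a \<Rightarrow> 'b"
    and act0 :: "'c \<Rightarrow> 'a \<Rightarrow> 'a" and act1 :: "'c \<Rightarrow> 'b \<Rightarrow> 'b"
    and br :: "'a \<Rightarrow> 'a \<Rightarrow> 'b"
  assumes "braided_equivariant_crossed_module \<Gamma> G1 G0 bd ract act0 act1 br"
    and "\<And>g h. \<lbrakk>g \<in> carrier G0; h \<in> carrier G0\<rbrakk> \<Longrightarrow> br g h \<otimes>\<^bsub>G1\<^esub> br h g = \<one>\<^bsub>G1\<^esub>"
  shows "comm_group (braided_equivariant_crossed_module.H1 \<Gamma> G1 G0 bd ract act0 act1 br)"
proof -
  interpret braided_equivariant_crossed_module \<Gamma> G1 G0 bd ract act0 act1 br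
    by (fact assms(1))
  let ?Z = "\<lparr>carrier = Z1, mult = cocycle_mult, one = cocycle_one\<rparr>"
  note commute = cocycle_mult_commute[OF _ _ assms(2)]
  have "comm_group \<lparr>carrier = carrier ?Z // cocycle_iso,
      mult = (\<lambda>X Y. \<Union>x\<in>X. \<Union>y\<in>Y. cocycle_iso `` {x \<otimes>\<^bsub>?Z\<^esub> y}), one = cocycle_iso `` {\<one>\<^bsub>?Z\<^esub>}\<rparr>"
  proof (rule comm_group_quotient)
    fix x assume "x \<in> carrier ?Z"
    then obtain y where "y \<in> Z1" "cocycle_mult x y = cocycle_one"
      using cocycle_right_inverse[of x] by auto
    moreover have "(cocycle_one, cocycle_one) \<in> cocycle_iso"
      using cocycle_one_mem by (simp add: equiv_class_eq_iff[OF equiv_cocycle_iso])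
    ultimately show "\<exists>y\<in>carrier ?Z. (x \<otimes>\<^bsub>?Z\<^esub> y, \<one>\<^bsub>?Z\<^esub>) \<in> cocycle_iso"
      by (auto intro!: bexI[of _ y])
  qed (simp_all add: equiv_cocycle_iso cocycle_mult_closed cocycle_one_mem cocycle_mult_assoc
      cocycle_mult_one_left cocycle_mult_iso_left commute)
  then show ?thesis
    by (simp add: H1_def)
qed

end
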